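(* Assume that the constitutive coefficients satisfy $\mu>0$, $\mu_{\rm c}>0$, $2\lambda+\mu>0$, $b_1>0$, $b_2>0$, $b_3>0$. Let $c_2^+$ denote the smallest eigenvalue of the quadratic form $W_{\mathrm{curv}}(S)$, and let $c_1^+$ and $C_1^+>0$ denote the smallest and the largest eigenvalues of the quadratic form $W_{\mathrm{shell}}(S)$ (quadratic forms on $\mathbb{R}^{3\times3}$ with the Frobenius norm). Let the thickness $h>0$ satisfy one of the following conditions (on $\omega$, with $\kappa_1,\kappa_2$ the principal curvatures of $y_0(\omega)$): i) $h|\kappa_1|<\frac12$, $h|\kappa_2|<\frac12$ and $h^2<\left(\frac{47}{4}\right)^2(5-2\sqrt6)\,\frac{c_2^+}{C_1^+}$; ii) $h|\kappa_1|<\frac1a$, $h|\kappa_2|<\frac1a$ with $a>\max\Big\{1+\frac{\sqrt2}{2},\ \frac{1+\sqrt{1+3\frac{C_1^+}{c_1^+}}}{2}\Big\}$. Then the energy density $W^{(h^3)}(\mathcal{E}_{m,s},\mathcal{K}_{e,s})$ is uniformly convex in $(\mathcal{E}_{m,s},\mathcal{K}_{e,s})$, i.e., there exists a constant $a_1^+>0$ such that $$D^2W^{(h^3)}(\mathcal{E}_{m,s},\mathcal{K}_{e,s}).[(H_1,H_2),(H_1,H_2)]\ \ge\ a_1^+\big(\lVert H_1\rVert^2+\lVert H_2\rVert^2\big)\qquad\forall\,H_1,H_2\in\mathbb{R}^{3\times3}.$$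
   Context: Notation: $\langle X,Y\rangle=\mathrm{tr}(XY^T)$ and $\lVert X\rVert^2=\langle X,X\rangle$ (Frobenius); $\mathrm{sym}\,X=\frac12(X+X^T)$, $\mathrm{skew}\,X=\frac12(X-X^T)$, $\mathrm{dev}\,X=X-\frac13\mathrm{tr}(X)\,\mathbb{1}_3$ for $X\in\mathbb{R}^{3\times3}$, with $\mathbb 1_3$ the identity. For a $3\times 2$ matrix $M$ and a vector $v$, $(M|v)$ is the $3\times3$ matrix obtained by appending the column $v$. Geometry: $\omega\subset\mathbb{R}^2$ is a bounded domain with Lipschitz boundary, $h>0$ is the constant thickness, $y_0:\omega\to\mathbb{R}^3$ is a $C^2$ map parametrizing the midsurface of the curved reference configuration, $n_0=\frac{\partial_{x_1}y_0\times\partial_{x_2}y_0}{\lVert\partial_{x_1}y_0\times\partial_{x_2}y_0\rVert}$, and $\Theta(x_1,x_2,x_3)=y_0(x_1,x_2)+x_3\,n_0(x_1,x_2)$ is assumed to be a $C^1$-diffeomorphism from $\Omega_h=\omega\times(-\frac h2,\frac h2)$ onto its image. Then $\nabla_x\Theta(0)=(\nabla y_0|n_0)$ (value at $x_3=0$). Put $\mathrm{I}_{y_0}=(\nabla y_0)^T\nabla y_0$, $\mathrm{II}_{y_0}=-(\nabla y_0)^T\nabla n_0$, $\mathrm{L}_{y_0}=\mathrm{I}_{y_0}^{-1}\mathrm{II}_{y_0}$, $\mathrm{K}=\det\mathrm{L}_{y_0}$ (Gauss curvature), $\mathrm{H}=\frac12\mathrm{tr}\,\mathrm{L}_{y_0}$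 (mean curvature); $\kappa_1,\kappa_2$ are the eigenvalues of $\mathrm{L}_{y_0}$. Define $$\mathrm{B}_{y_0}=-(\nabla n_0|0)[\nabla_x\Theta(0)]^{-1},\qquad \mathrm{C}_{y_0}=\det(\nabla_x\Theta(0))\,[\nabla_x\Theta(0)]^{-T}\begin{pmatrix}0&1&0\\-1&0&0\\0&0&0\end{pmatrix}[\nabla_x\Theta(0)]^{-1}.$$ Energy: at each point of $\omega$, $W^{(h^3)}$ is regarded as a function of two matrix variables $\mathcal E=\mathcal{E}_{m,s}$ (elastic shell strain tensor) and $\mathcal K=\mathcal{K}_{e,s}$ (elastic shell bending-curvature tensor) in $\mathbb{R}^{3\times3}$, and $D^2W^{(h^3)}$ is its second derivative with respect to these variables: $$\begin{aligned}W^{(h^3)}(\mathcal E,\mathcal K)=&\Big(h+\mathrm K\tfrac{h^3}{12}\Big)W_{\mathrm{shell}}(\mathcal E)+\tfrac{h^3}{12}W_{\mathrm{shell}}(\mathcal E\mathrm B_{y_0}+\mathrm C_{y_0}\mathcal K)-\tfrac{h^3}{3}\mathrm H\,\mathcal W_{\mathrm{shell}}(\mathcal E,\mathcal E\mathrm B_{y_0}+\mathrm C_{y_0}\mathcal K)\\&+\tfrac{h^3}{6}\mathcal W_{\mathrm{shell}}(\mathcal E,(\mathcal E\mathrm B_{y_0}+\mathrm C_{y_0}\mathcal K)\mathrm B_{y_0})+\Big(h-\mathrm K\tfrac{h^3}{12}\Big)W_{\mathrm{curv}}(\mathcal K)+\tfrac{h^3}{12}W_{\mathrm{curv}}(\mathcal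 K\mathrm B_{y_0}),\end{aligned}$$ where $$W_{\mathrm{shell}}(S)=\mu\lVert\mathrm{sym}\,S\rVert^2+\mu_{\rm c}\lVert\mathrm{skew}\,S\rVert^2+\tfrac{\lambda\mu}{\lambda+2\mu}[\mathrm{tr}\,S]^2,$$ $$\mathcal W_{\mathrm{shell}}(S,T)=\mu\langle\mathrm{sym}\,S,\mathrm{sym}\,T\rangle+\mu_{\rm c}\langle\mathrm{skew}\,S,\mathrm{skew}\,T\rangle+\tfrac{\lambda\mu}{\lambda+2\mu}\mathrm{tr}(S)\,\mathrm{tr}(T),$$ $$W_{\mathrm{curv}}(S)=\mu L_{\rm c}^2\big(b_1\lVert\mathrm{dev}\,\mathrm{sym}\,S\rVert^2+b_2\lVert\mathrm{skew}\,S\rVert^2+b_3[\mathrm{tr}\,S]^2\big).$$ Here $\mu,\lambda,\mu_{\rm c},b_1,b_2,b_3$ are real constitutive coefficients and $L_{\rm c}>0$ is a fixed internal length. Thus $c_1^+\lVert S\rVert^2\le W_{\mathrm{shell}}(S)\le C_1^+\lVert S\rVert^2$ and $c_2^+\lVert S\rVert^2\le W_{\mathrm{curv}}(S)$ for all $S\in\mathbb{R}^{3\times3}$, with optimal constants. *)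

theory Defs
  imports "HOL-Analysis.Analysis"
begin

text \<open>Matrices are elements of \<open>real^'n^'m\<close> (\<open>m\<close> rows, \<open>n\<close> columns). The library inner product
  and norm on this type are the Frobenius ones: \<open>X \<bullet> Y = trace (X ** transpose Y)\<close>.\<close>

lemma inner_eq_trace:
  fixes X Y :: "real^'n^'m"
  shows "X \<bullet> Y = trace (X ** transpose Y)"
  by (simp add: inner_vec_def trace_def matrix_matrix_mult_def transpose_def)


section \<open>Matrix operations\<close>

definition sym_part :: "real^3^3 \<Rightarrow> real^3^3" where
  "sym_part X = (1/2) *\<^sub>R (X + transpose X)"

definition skew_part :: "real^3^3 \<Rightarrow> real^3^3" where
  "skew_part X = (1/2) *\<^sub>R (X - transpose X)"

definition dev :: "real^3^3 \<Rightarrow> real^3^3" where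
  "dev X = X - (trace X / 3) *\<^sub>R mat 1"

definition append_col :: "real^2^3 \<Rightarrow> real^3 \<Rightarrow> real^3^3" where
  "append_col M v = (\<chi> i j. if j = 1 then M $ i $ 1 else if j = 2 then M $ i $ 2 else v $ i)"

definition eigenvalues :: "real^'n^'n \<Rightarrow> real set" where
  "eigenvalues A = {k. \<exists>v. v \<noteq> 0 \<and> A *v v = k *s v}"


section \<open>Eigenvalues of quadratic forms\<close>

text \<open>The eigenvalues of a quadratic form \<open>q\<close> on a Euclidean space are those of the self-adjoint map
  that represents its polar form with respect to the inner product.\<close>

definition polar_form :: "('a::real_inner \<Rightarrow> real) \<Rightarrow> 'a \<Rightarrow> 'a \<Rightarrow> real" where
  "polar_form q S T = (q (S + T) - q S - q T) / 2"

definition form_eigenvalues :: "('a::real_inner \<Rightarrow> real) \<Rightarrow> real set" where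
  "form_eigenvalues q = {c. \<exists>S. S \<noteq> 0 \<and> (\<forall>T. polar_form q S T = c * (S \<bullet> T))}"

definition smallest_eigenvalue :: "('a::real_inner \<Rightarrow> real) \<Rightarrow> real \<Rightarrow> bool" where
  "smallest_eigenvalue q c \<longleftrightarrow> c \<in> form_eigenvalues q \<and> (\<forall>d \<in> form_eigenvalues q. c \<le> d)"

definition largest_eigenvalue :: "('a::real_inner \<Rightarrow> real) \<Rightarrow> real \<Rightarrow> bool" where
  "largest_eigenvalue q c \<longleftrightarrow> c \<in> form_eigenvalues q \<and> (\<forall>d \<in> form_eigenvalues q. d \<le> c)"


section \<open>Regularity of maps and domains\<close>

text \<open>The two-sided derivative \<open>at x\<close> is used, so these notions are meant for open sets.\<close>

definition C1_on :: "('a::real_normed_vector \<Rightarrow> 'b::real_normed_vector) \<Rightarrow> 'a set \<Rightarrow> bool" where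
  "C1_on f S \<longleftrightarrow> (\<exists>f'. (\<forall>x\<in>S. (f has_derivative blinfun_apply (f' x)) (at x)) \<and> continuous_on S f')"

definition C2_on :: "('a::real_normed_vector \<Rightarrow> 'b::real_normed_vector) \<Rightarrow> 'a set \<Rightarrow> bool" where
  "C2_on f S \<longleftrightarrow> (\<exists>f'. (\<forall>x\<in>S. (f has_derivative blinfun_apply (f' x)) (at x)) \<and> C1_on f' S)"

definition C1_diffeo_onto_image :: "('a::real_normed_vector \<Rightarrow> 'b::real_normed_vector) \<Rightarrow> 'a set \<Rightarrow> bool"
  where "C1_diffeo_onto_image f S \<longleftrightarrow>
    C1_on f S \<and> inj_on f S \<and> open (f ` S) \<and> C1_on (inv_into S f) (f ` S)"

definition D2 :: "('a::real_normed_vector \<Rightarrow> real) \<Rightarrow> 'a \<Rightarrow> 'a \<Rightarrow> 'a \<Rightarrow> real" where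
  "D2 f p u v = frechet_derivative (\<lambda>q. frechet_derivative f (at q) u) (at p) v"

text \<open>Near each boundary point, in suitable Cartesian coordinates, the set is the region above the
  graph of a Lipschitz function.\<close>

definition lipschitz_boundary :: "(real^2) set \<Rightarrow> bool" where
  "lipschitz_boundary S \<longleftrightarrow> (\<forall>p \<in> frontier S.
     \<exists>(Q :: real^2 \<Rightarrow> real^2) (\<phi> :: real \<Rightarrow> real) L r.
       orthogonal_transformation Q \<and> L-lipschitz_on UNIV \<phi> \<and> r > 0 \<and>
       S \<inter> ball p r = {x \<in> ball p r. \<phi> (Q x $ 1) < Q x $ 2})"

definition bounded_lipschitz_domain :: "(real^2) set \<Rightarrow> bool" where
  "bounded_lipschitz_domain S \<longleftrightarrow>
     open S \<and> connected S \<and> S \<noteq> {} \<and> bounded S \<and> lipschitz_boundary S"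


section \<open>Geometry of the midsurface\<close>

definition normal_field :: "(real^2 \<Rightarrow> real^3) \<Rightarrow> real^2 \<Rightarrow> real^3" where
  "normal_field y0 x =
     (let v = cross3 (column 1 (jacobian y0 (at x))) (column 2 (jacobian y0 (at x))) in v /\<^sub>R norm v)"

definition base_point :: "real^3 \<Rightarrow> real^2" where
  "base_point z = vector [z $ 1, z $ 2]"

definition Theta :: "(real^2 \<Rightarrow> real^3) \<Rightarrow> real^3 \<Rightarrow> real^3" where
  "Theta y0 z = y0 (base_point z) + z $ 3 *\<^sub>R normal_field y0 (base_point z)"

definition shell_body :: "(real^2) set \<Rightarrow> real \<Rightarrow> (real^3) set" where
  "shell_body \<omega> h = {z. base_point z \<in> \<omega> \<and> - h/2 < z $ 3 \<and> z $ 3 < h/2}"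

definition grad_Theta0 :: "(real^2 \<Rightarrow> real^3) \<Rightarrow> real^2 \<Rightarrow> real^3^3" where
  "grad_Theta0 y0 x = jacobian (Theta y0) (at (vector [x $ 1, x $ 2, 0]))"

lemma grad_Theta0_eq:
  assumes y: "y0 differentiable at x" and n: "normal_field y0 differentiable at x"
  shows "grad_Theta0 y0 x = append_col (jacobian y0 (at x)) (normal_field y0 x)"
proof -
  let ?z = "vector [x $ 1, x $ 2, 0] :: real^3"
  let ?A = "jacobian y0 (at x)" and ?N = "jacobian (normal_field y0) (at x)"
  have bz: "base_point ?z = x"
    by (simp add: base_point_def vec_eq_iff forall_2)
  have lin: "linear base_point"
    by (rule linearI) (simp_all add: base_point_def vec_eq_iff forall_2)
  have db: "(base_point has_derivative base_point) (at ?z)"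
    using lin by (simp add: linear_imp_has_derivative)
  have dy: "((\<lambda>z. y0 (base_point z)) has_derivative (\<lambda>k. ?A *v base_point k)) (at ?z)"
    using has_derivative_compose[OF db, of y0 "\<lambda>k. ?A *v k"] y
    by (simp add: bz jacobian_works)
  have dn: "((\<lambda>z. normal_field y0 (base_point z)) has_derivative (\<lambda>k. ?N *v base_point k)) (at ?z)"
    using has_derivative_compose[OF db, of "normal_field y0" "\<lambda>k. ?N *v k"] n
    by (simp add: bz jacobian_works)
  have d3: "((\<lambda>z::real^3. z $ 3) has_derivative (\<lambda>k. k $ 3)) (at ?z)"
    by (rule bounded_linear_imp_has_derivative[OF bounded_linear_vec_nth])
  have "(Theta y0 has_derivative
      (\<lambda>k. ?A *v base_point k + (?z $ 3 *\<^sub>R (?N *v base_point k) + k $ 3 *\<^sub>R normal_field y0 (base_point ?z))))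
      (at ?z)"
    unfolding Theta_def[abs_def]
    by (intro has_derivative_add dy has_derivative_scaleR d3 dn)
  then have D: "(Theta y0 has_derivative (\<lambda>k. ?A *v base_point k + k $ 3 *\<^sub>R normal_field y0 x)) (at ?z)"
    by (simp add: bz)
  have "(\<lambda>k. ?A *v base_point k + k $ 3 *\<^sub>R normal_field y0 x)
      = (*v) (append_col ?A (normal_field y0 x))"
    by (rule ext) (simp add: vec_eq_iff matrix_vector_mult_def append_col_def base_point_def
        sum_2 sum_3 mult.commute)
  with D have "frechet_derivative (Theta y0) (at ?z) = (*v) (append_col ?A (normal_field y0 x))"
    using frechet_derivative_at by metis
  then show ?thesis
    by (simp add: grad_Theta0_def jacobian_def)
qed

definition fund_form1 :: "(real^2 \<Rightarrow> real^3) \<Rightarrow> real^2 \<Rightarrow> real^2^2" where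
  "fund_form1 y0 x = transpose (jacobian y0 (at x)) ** jacobian y0 (at x)"

definition fund_form2 :: "(real^2 \<Rightarrow> real^3) \<Rightarrow> real^2 \<Rightarrow> real^2^2" where
  "fund_form2 y0 x = - (transpose (jacobian y0 (at x)) ** jacobian (normal_field y0) (at x))"

definition Weingarten :: "(real^2 \<Rightarrow> real^3) \<Rightarrow> real^2 \<Rightarrow> real^2^2" where
  "Weingarten y0 x = matrix_inv (fund_form1 y0 x) ** fund_form2 y0 x"

definition gauss_curv :: "(real^2 \<Rightarrow> real^3) \<Rightarrow> real^2 \<Rightarrow> real" where
  "gauss_curv y0 x = det (Weingarten y0 x)"

definition mean_curv :: "(real^2 \<Rightarrow> real^3) \<Rightarrow> real^2 \<Rightarrow> real" where
  "mean_curv y0 x = trace (Weingarten y0 x) / 2"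

definition B_mat :: "(real^2 \<Rightarrow> real^3) \<Rightarrow> real^2 \<Rightarrow> real^3^3" where
  "B_mat y0 x = - (append_col (jacobian (normal_field y0) (at x)) 0 ** matrix_inv (grad_Theta0 y0 x))"

definition C_mat :: "(real^2 \<Rightarrow> real^3) \<Rightarrow> real^2 \<Rightarrow> real^3^3" where
  "C_mat y0 x = det (grad_Theta0 y0 x) *\<^sub>R
     (transpose (matrix_inv (grad_Theta0 y0 x))
      ** vector [vector [0, 1, 0], vector [-1, 0, 0], vector [0, 0, 0]]
      ** matrix_inv (grad_Theta0 y0 x))"


section \<open>The shell energy\<close>

definition W_shell :: "real \<Rightarrow> real \<Rightarrow> real \<Rightarrow> real^3^3 \<Rightarrow> real" where
  "W_shell \<mu> lam \<mu>c S =
     \<mu> * (norm (sym_part S))\<^sup>2 + \<mu>c * (norm (skew_part S))\<^sup>2 + lam * \<mu> / (lam + 2 * \<mu>) * (trace S)\<^sup>2"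

definition W_shell_bilin :: "real \<Rightarrow> real \<Rightarrow> real \<Rightarrow> real^3^3 \<Rightarrow> real^3^3 \<Rightarrow> real" where
  "W_shell_bilin \<mu> lam \<mu>c S T =
     \<mu> * (sym_part S \<bullet> sym_part T) + \<mu>c * (skew_part S \<bullet> skew_part T)
     + lam * \<mu> / (lam + 2 * \<mu>) * (trace S * trace T)"

definition W_curv :: "real \<Rightarrow> real \<Rightarrow> real \<Rightarrow> real \<Rightarrow> real \<Rightarrow> real^3^3 \<Rightarrow> real" where
  "W_curv \<mu> Lc b1 b2 b3 S =
     \<mu> * Lc\<^sup>2 * (b1 * (norm (dev (sym_part S)))\<^sup>2 + b2 * (norm (skew_part S))\<^sup>2 + b3 * (trace S)\<^sup>2)"

definition W_h3 ::
  "real \<Rightarrow> real \<Rightarrow> real \<Rightarrow> real \<Rightarrow> real \<Rightarrow> real \<Rightarrow> real \<Rightarrow> real \<Rightarrow> (real^2 \<Rightarrow> real^3) \<Rightarrow> real^2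
   \<Rightarrow> (real^3^3) \<times> (real^3^3) \<Rightarrow> real" where
  "W_h3 h \<mu> lam \<mu>c Lc b1 b2 b3 y0 x = (\<lambda>(E, K).
     let B = B_mat y0 x; C = C_mat y0 x; G = gauss_curv y0 x; H = mean_curv y0 x; Z = E ** B + C ** K in
       (h + G * h^3 / 12) * W_shell \<mu> lam \<mu>c E
       + h^3 / 12 * W_shell \<mu> lam \<mu>c Z
       - h^3 / 3 * H * W_shell_bilin \<mu> lam \<mu>c E Z
       + h^3 / 6 * W_shell_bilin \<mu> lam \<mu>c E (Z ** B)
       + (h - G * h^3 / 12) * W_curv \<mu> Lc b1 b2 b3 K
       + h^3 / 12 * W_curv \<mu> Lc b1 b2 b3 (K ** B))"

end

theory Submission
  imports Defs
begin

text \<open>The energy is quadratic, so its second derivative is twice the energy and uniform convexity is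
  coercivity with a constant independent of the point. At each point the tensor \<open>B_mat\<close> is
  self-adjoint (by the symmetry of the second derivative of \<open>y0\<close>) with the unit normal in its kernel,
  so in an orthonormal frame of principal directions and normal it is \<open>diag(p, q, 0)\<close> with principal
  curvatures \<open>p\<close>, \<open>q\<close>, while \<open>C_mat\<close> is the rotation by a right angle in the tangent plane. The energies
  are invariant under orthogonal conjugation, and after rescaling \<open>B\<close> and \<open>K\<close> by \<open>h\<close> it remains to absorb
  the mixed terms by the Cauchy-Schwarz inequality for \<open>W_shell\<close>. The constants \<open>c1\<close>, \<open>C1\<close>, \<open>c2\<close> are
  explicit, because sym-dev, skew and trace parts are the eigenspaces of both forms.\<close>

section \<open>The quadratic forms\<close>

text \<open>Two separate estimates are needed because the conditions control different ratios.
  Condition ii) bounds the curvatures in terms of \<open>C1 / c1\<close>: there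
  \<open>Z = E B + C K\<close> can be treated as an independent variable, since a right
  multiplication by \<open>B\<close> costs at most the curvature bound times the square root of that
  ratio. Condition i) ties \<open>h\<close> to \<open>c2 / C1\<close> and gives no control of
  \<open>C1 / c1\<close>, so \<open>W (Z B)\<close> cannot be compared with \<open>W Z\<close>
  through Frobenius norms. The way out is algebraic: the mean curvature term of the energy is
  exactly the multiple of \<open>Z\<close> that Cayley-Hamilton extracts from \<open>Z B\<close>,
  and it cancels. What survives is a multiple of \<open>W E\<close>, the normal column of
  \<open>E\<close>, and terms in \<open>K\<close>, which are paid for by \<open>W_curv\<close>.
  After the rescaling, the bound on \<open>h\<close> says that \<open>16 * W_curv\<close> with
  length \<open>Lc / h\<close> dominates \<open>C1\<close> times the squared norm.\<close>

definition W_curv_bilin ::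
  "real \<Rightarrow> real \<Rightarrow> real \<Rightarrow> real \<Rightarrow> real \<Rightarrow> real^3^3 \<Rightarrow> real^3^3 \<Rightarrow> real" where
  "W_curv_bilin \<mu> Lc b1 b2 b3 S T =
     \<mu> * Lc\<^sup>2 * (b1 * (dev (sym_part S) \<bullet> dev (sym_part T)) + b2 * (skew_part S \<bullet> skew_part T)
                + b3 * (trace S * trace T))"

lemma W_shell_bilin_same: "W_shell_bilin \<mu> lam \<mu>c S S = W_shell \<mu> lam \<mu>c S"
  by (simp add: W_shell_bilin_def W_shell_def power2_norm_eq_inner power2_eq_square[of "trace S"])

lemma W_curv_bilin_same: "W_curv_bilin \<mu> Lc b1 b2 b3 S S = W_curv \<mu> Lc b1 b2 b3 S"
  by (simp add: W_curv_bilin_def W_curv_def power2_norm_eq_inner power2_eq_square[of "trace S"])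

lemma linear_sym_part: "linear sym_part"
  by (rule linearI) (simp_all add: sym_part_def transpose_def vec_eq_iff algebra_simps)

lemma linear_skew_part: "linear skew_part"
  by (rule linearI) (simp_all add: skew_part_def transpose_def vec_eq_iff algebra_simps)

lemma linear_trace: "linear (trace :: real^'n^'n \<Rightarrow> real)"
  by (rule linearI) (simp_all add: trace_def sum.distrib sum_distrib_left)

lemma linear_dev: "linear dev"
  by (rule linearI)
    (simp_all add: dev_def linear_add[OF linear_trace] linear_cmul[OF linear_trace]
      algebra_simps add_divide_distrib)

lemmas parts_linear =
  linear_add[OF linear_sym_part] linear_add[OF linear_skew_part] linear_add[OF linear_trace]
  linear_add[OF linear_dev]
  linear_cmul[OF linear_sym_part] linear_cmul[OF linear_skew_part] linear_cmul[OF linear_trace]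
  linear_cmul[OF linear_dev]

lemma bilinear_W_shell: "bilinear (W_shell_bilin \<mu> lam \<mu>c)"
  unfolding bilinear_def
  by (intro conjI allI linearI)
    (simp_all add: W_shell_bilin_def parts_linear inner_add_left inner_add_right algebra_simps
      add_divide_distrib)

lemma bilinear_W_curv: "bilinear (W_curv_bilin \<mu> Lc b1 b2 b3)"
  unfolding bilinear_def
  by (intro conjI allI linearI)
    (simp_all add: W_curv_bilin_def parts_linear inner_add_left inner_add_right algebra_simps)

lemma W_shell_bilin_sym: "W_shell_bilin \<mu> lam \<mu>c S T = W_shell_bilin \<mu> lam \<mu>c T S"
  by (simp add: W_shell_bilin_def inner_commute mult.commute)

lemma W_shell_add:
  "W_shell \<mu> lam \<mu>c (S + T) = W_shell \<mu> lam \<mu>c S + 2 * W_shell_bilin \<mu> lam \<mu>c S T + W_shell \<mu> lam \<mu>c T"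
  by (simp add: W_shell_bilin_same[symmetric] bilinear_ladd[OF bilinear_W_shell]
      bilinear_radd[OF bilinear_W_shell] W_shell_bilin_sym[of _ _ _ T S])

lemma W_shell_scale: "W_shell \<mu> lam \<mu>c (r *\<^sub>R S) = r\<^sup>2 * W_shell \<mu> lam \<mu>c S"
  by (simp add: W_shell_bilin_same[symmetric] bilinear_lmul[OF bilinear_W_shell]
      bilinear_rmul[OF bilinear_W_shell] power2_eq_square)

lemma W_curv_add:
  "W_curv \<mu> Lc b1 b2 b3 (S + T)
    = W_curv \<mu> Lc b1 b2 b3 S + 2 * W_curv_bilin \<mu> Lc b1 b2 b3 S T + W_curv \<mu> Lc b1 b2 b3 T"
  by (simp add: W_curv_bilin_same[symmetric] bilinear_ladd[OF bilinear_W_curv]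
      bilinear_radd[OF bilinear_W_curv]) (simp add: W_curv_bilin_def inner_commute)

lemma W_curv_scale: "W_curv \<mu> Lc b1 b2 b3 (r *\<^sub>R S) = r\<^sup>2 * W_curv \<mu> Lc b1 b2 b3 S"
  by (simp add: W_curv_bilin_same[symmetric] bilinear_lmul[OF bilinear_W_curv]
      bilinear_rmul[OF bilinear_W_curv] power2_eq_square)

text \<open>The three parts are mutually orthogonal, and the spherical part
  \<open>(trace S / 3) *\<^sub>R mat 1\<close> has squared norm
  \<open>(trace S)\<^sup>2 / 3\<close>. This fixes the normalisation of the last summand in all
  weighted forms below.\<close>

lemma norm_split: "(norm S)\<^sup>2 = (norm (dev (sym_part S)))\<^sup>2 + (norm (skew_part S))\<^sup>2 + (trace S)\<^sup>2 / 3"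
  unfolding power2_norm_eq_inner
  by (simp add: dev_def sym_part_def skew_part_def trace_def transpose_def
      inner_vec_def mat_def sum_3) (simp add: power2_eq_square field_simps)

lemma W_shell_split:
  "W_shell \<mu> lam \<mu>c S = \<mu> * (norm (dev (sym_part S)))\<^sup>2 + \<mu>c * (norm (skew_part S))\<^sup>2
     + (\<mu> + 3 * (lam * \<mu> / (lam + 2 * \<mu>))) * ((trace S)\<^sup>2 / 3)"
proof -
  have "(norm (sym_part S))\<^sup>2 = (norm (dev (sym_part S)))\<^sup>2 + (trace S)\<^sup>2 / 3"
    unfolding power2_norm_eq_inner
    by (simp add: dev_def sym_part_def trace_def transpose_def
      inner_vec_def mat_def sum_3) (simp add: power2_eq_square field_simps)
  then show ?thesis
    by (simp add: W_shell_def algebra_simps)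
qed

lemma W_curv_split:
  "W_curv \<mu> Lc b1 b2 b3 S = (\<mu> * Lc\<^sup>2 * b1) * (norm (dev (sym_part S)))\<^sup>2
     + (\<mu> * Lc\<^sup>2 * b2) * (norm (skew_part S))\<^sup>2 + (3 * (\<mu> * Lc\<^sup>2 * b3)) * ((trace S)\<^sup>2 / 3)"
  by (simp add: W_curv_def algebra_simps)

lemma weighted_lower:
  assumes "c \<le> u" "c \<le> v" "c \<le> (w::real)"
  shows "c * (norm S)\<^sup>2
    \<le> u * (norm (dev (sym_part S)))\<^sup>2 + v * (norm (skew_part S))\<^sup>2 + w * ((trace S)\<^sup>2 / 3)"
  unfolding norm_split[of S] distrib_left
  by (intro add_mono mult_right_mono assms) auto

lemma weighted_upper:
  assumes "u \<le> c" "v \<le> c" "w \<le> (c::real)"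
  shows "u * (norm (dev (sym_part S)))\<^sup>2 + v * (norm (skew_part S))\<^sup>2 + w * ((trace S)\<^sup>2 / 3)
     \<le> c * (norm S)\<^sup>2"
  unfolding norm_split[of S] distrib_left
  by (intro add_mono mult_right_mono assms) auto

lemma polar_form_W_shell: "polar_form (W_shell \<mu> lam \<mu>c) S T = W_shell_bilin \<mu> lam \<mu>c S T"
  by (simp add: polar_form_def W_shell_add)

lemma polar_form_W_curv: "polar_form (W_curv \<mu> Lc b1 b2 b3) S T = W_curv_bilin \<mu> Lc b1 b2 b3 S T"
  by (simp add: polar_form_def W_curv_add)

section \<open>Eigenmatrices and eigenvalues of the two forms\<close>

definition diag2 :: "real \<Rightarrow> real \<Rightarrow> real^3^3" where
  "diag2 p q = vector [vector [p,0,0], vector [0,q,0], vector [0,0,0]]"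

definition J12 :: "real^3^3" where
  "J12 = vector [vector [0,1,0], vector [-1,0,0], vector [0,0,0]]"

text \<open>One test matrix is taken from each eigenspace: trace-free symmetric, skew, spherical.
  Extremality of \<open>c1\<close> and \<open>C1\<close> then places all three weights in the
  interval from \<open>c1\<close> to \<open>C1\<close>, which turns the spectral hypotheses into
  norm bounds.\<close>

lemma weights_shell_eigenvalues:
  "{\<mu>, \<mu>c, \<mu> + 3 * (lam * \<mu> / (lam + 2 * \<mu>))} \<subseteq> form_eigenvalues (W_shell \<mu> lam \<mu>c)"
proof -
  have "diag2 1 (-1) \<noteq> 0" "J12 \<noteq> 0" "mat 1 \<noteq> (0::real^3^3)"
    by (simp_all add: diag2_def J12_def vec_eq_iff forall_3 mat_def)
  moreover have "W_shell_bilin \<mu> lam \<mu>c (diag2 1 (-1)) T = \<mu> * (diag2 1 (-1) \<bullet> T)" for T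
    by (simp add: W_shell_bilin_def diag2_def sym_part_def skew_part_def trace_def transpose_def
        inner_vec_def mat_def sum_3)
  moreover have "W_shell_bilin \<mu> lam \<mu>c J12 T = \<mu>c * (J12 \<bullet> T)" for T
    by (simp add: W_shell_bilin_def J12_def sym_part_def skew_part_def trace_def transpose_def
        inner_vec_def mat_def sum_3)
  moreover have "W_shell_bilin \<mu> lam \<mu>c (mat 1) T
      = (\<mu> + 3 * (lam * \<mu> / (lam + 2 * \<mu>))) * (mat 1 \<bullet> T)" for T
    by (simp add: W_shell_bilin_def sym_part_def skew_part_def trace_def transpose_def
        inner_vec_def mat_def sum_3) (simp add: algebra_simps add_divide_distrib)
  ultimately show ?thesis
    unfolding form_eigenvalues_def polar_form_W_shell by blast
qed

lemma weights_curv_eigenvalues: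
  "{\<mu> * Lc\<^sup>2 * b1, \<mu> * Lc\<^sup>2 * b2, 3 * (\<mu> * Lc\<^sup>2 * b3)} \<subseteq> form_eigenvalues (W_curv \<mu> Lc b1 b2 b3)"
proof -
  have "diag2 1 (-1) \<noteq> 0" "J12 \<noteq> 0" "mat 1 \<noteq> (0::real^3^3)"
    by (simp_all add: diag2_def J12_def vec_eq_iff forall_3 mat_def)
  moreover have "W_curv_bilin \<mu> Lc b1 b2 b3 (diag2 1 (-1)) T = \<mu> * Lc\<^sup>2 * b1 * (diag2 1 (-1) \<bullet> T)" for T
    by (simp add: W_curv_bilin_def diag2_def dev_def sym_part_def skew_part_def trace_def transpose_def
        inner_vec_def mat_def sum_3) (simp add: field_simps)
  moreover have "W_curv_bilin \<mu> Lc b1 b2 b3 J12 T = \<mu> * Lc\<^sup>2 * b2 * (J12 \<bullet> T)" for T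
    by (simp add: W_curv_bilin_def J12_def dev_def sym_part_def skew_part_def trace_def transpose_def
        inner_vec_def mat_def sum_3)
  moreover have "W_curv_bilin \<mu> Lc b1 b2 b3 (mat 1) T = 3 * (\<mu> * Lc\<^sup>2 * b3) * (mat 1 \<bullet> T)" for T
    by (simp add: W_curv_bilin_def dev_def sym_part_def skew_part_def trace_def transpose_def
        inner_vec_def mat_def sum_3)
  ultimately show ?thesis
    unfolding form_eigenvalues_def polar_form_W_curv by blast
qed

text \<open>Testing the eigenvector equation against \<open>S\<close> itself suffices. The lemma
  supplies \<open>c1 > 0\<close>, which has to be derived from the signs of the
  coefficients.\<close>

lemma form_eigenvalue_bound:
  assumes "c \<in> form_eigenvalues q" and "\<And>S. polar_form q S S = q S"
    and "\<And>S. d * (norm S)\<^sup>2 \<le> q S"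
  shows "d \<le> c"
proof -
  obtain S where "S \<noteq> 0" "polar_form q S S = c * (S \<bullet> S)"
    using assms(1) by (auto simp: form_eigenvalues_def)
  with assms(2,3)[of S] have "d * (norm S)\<^sup>2 \<le> c * (norm S)\<^sup>2"
    by (simp add: power2_norm_eq_inner)
  with \<open>S \<noteq> 0\<close> show ?thesis by simp
qed


section \<open>Coercivity in principal axes\<close>

text \<open>The geometric data are free parameters here, so that they can be rescaled and conjugated
  independently of any surface.\<close>

definition shell_energy ::
  "real \<Rightarrow> real \<Rightarrow> real \<Rightarrow> real \<Rightarrow> real \<Rightarrow> real \<Rightarrow> real \<Rightarrow> real \<Rightarrow> real^3^3 \<Rightarrow> real^3^3 \<Rightarrow> real \<Rightarrow> real
   \<Rightarrow> real^3^3 \<Rightarrow> real^3^3 \<Rightarrow> real" where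
  "shell_energy \<mu> lam \<mu>c Lc b1 b2 b3 h B C G H E K =
     (h + G * h^3 / 12) * W_shell \<mu> lam \<mu>c E
     + h^3 / 12 * W_shell \<mu> lam \<mu>c (E ** B + C ** K)
     - h^3 / 3 * H * W_shell_bilin \<mu> lam \<mu>c E (E ** B + C ** K)
     + h^3 / 6 * W_shell_bilin \<mu> lam \<mu>c E ((E ** B + C ** K) ** B)
     + (h - G * h^3 / 12) * W_curv \<mu> Lc b1 b2 b3 K
     + h^3 / 12 * W_curv \<mu> Lc b1 b2 b3 (K ** B)"

lemma W_h3_eq:
  "W_h3 h \<mu> lam \<mu>c Lc b1 b2 b3 y0 x = (\<lambda>(E, K). shell_energy \<mu> lam \<mu>c Lc b1 b2 b3 h
    (B_mat y0 x) (C_mat y0 x) (gauss_curv y0 x) (mean_curv y0 x) E K)"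
  by (auto simp: W_h3_def shell_energy_def Let_def)

section \<open>Removal of the thickness by scaling\<close>

lemma W_curv_length_scale: "W_curv \<mu> (Lc / h) b1 b2 b3 S = W_curv \<mu> Lc b1 b2 b3 S / h\<^sup>2"
  by (simp add: W_curv_def power_divide)

lemmas matrix_mult_scaleR = scalar_matrix_assoc[symmetric] matrix_scalar_ac

text \<open>Nondimensionalisation: \<open>B\<close>, \<open>H\<close> and \<open>K\<close> are
  inverse lengths and \<open>G\<close> is an inverse square length, so each power of
  \<open>h\<close> is absorbed. Replacing \<open>Lc\<close> by \<open>Lc / h\<close> compensates the
  factor that \<open>h *\<^sub>R K\<close> brings into the curvature energy.\<close>

lemma shell_energy_scale:
  assumes "h > 0"
  shows "shell_energy \<mu> lam \<mu>c Lc b1 b2 b3 h B C G H E K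
    = h * shell_energy \<mu> lam \<mu>c (Lc / h) b1 b2 b3 1 (h *\<^sub>R B) C (h\<^sup>2 * G) (h * H) E (h *\<^sub>R K)"
proof -
  have Z: "E ** (h *\<^sub>R B) + C ** (h *\<^sub>R K) = h *\<^sub>R (E ** B + C ** K)"
    by (simp add: matrix_mult_scaleR scaleR_add_right)
  show ?thesis
    unfolding shell_energy_def Z
    unfolding matrix_mult_scaleR W_shell_scale W_curv_scale W_curv_length_scale
      bilinear_rmul[OF bilinear_W_shell]
    using assms by (simp add: field_simps power2_eq_square power3_eq_cube)
qed

lemma norm_sq_components:
  "(norm (S::real^3^3))\<^sup>2 = (S$1$1)\<^sup>2 + (S$1$2)\<^sup>2 + (S$1$3)\<^sup>2 + (S$2$1)\<^sup>2 + (S$2$2)\<^sup>2 + (S$2$3)\<^sup>2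
     + (S$3$1)\<^sup>2 + (S$3$2)\<^sup>2 + (S$3$3)\<^sup>2"
  unfolding power2_norm_eq_inner by (simp add: inner_vec_def sum_3 power2_eq_square)

lemma norm_dev_sym_components:
  "(norm (dev (sym_part S)))\<^sup>2
    = ((S$1$1 - S$2$2)\<^sup>2 + (S$2$2 - S$3$3)\<^sup>2 + (S$1$1 - S$3$3)\<^sup>2) / 3
      + ((S$1$2 + S$2$1)\<^sup>2 + (S$1$3 + S$3$1)\<^sup>2 + (S$2$3 + S$3$2)\<^sup>2) / 2"
  unfolding norm_sq_components
  by (simp add: dev_def sym_part_def trace_def transpose_def mat_def sum_3)
     (simp add: power2_eq_square field_simps)

lemma norm_skew_components:
  "(norm (skew_part S))\<^sup>2 = ((S$1$2 - S$2$1)\<^sup>2 + (S$1$3 - S$3$1)\<^sup>2 + (S$2$3 - S$3$2)\<^sup>2) / 2"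
  unfolding norm_sq_components
  by (simp add: skew_part_def transpose_def) (simp add: power2_eq_square field_simps)

section \<open>The shell form as an inner product\<close>

locale shell_coeffs =
  fixes \<mu> lam \<mu>c :: real
  assumes mu: "\<mu> > 0" and muc: "\<mu>c > 0" and lam: "2 * lam + \<mu> > 0"
begin

abbreviation "W \<equiv> W_shell \<mu> lam \<mu>c"
abbreviation "Wb \<equiv> W_shell_bilin \<mu> lam \<mu>c"

definition "bulk = \<mu> + 3 * (lam * \<mu> / (lam + 2 * \<mu>))"

lemma denom_pos: "lam + 2 * \<mu> > 0"
  using mu lam by linarith

lemma bulk_pos: "bulk > 0"
proof -
  have "bulk = 2 * \<mu> * (2 * lam + \<mu>) / (lam + 2 * \<mu>)"
    using denom_pos by (simp add: bulk_def field_simps)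
  then show ?thesis using mu lam denom_pos by simp
qed

text \<open>Allows the spherical weight to be charged to \<open>\<mu>\<close> alone; it follows from
  \<open>lam \<le> lam + 2 * \<mu>\<close> and the positive denominator.\<close>

lemma bulk_le: "bulk \<le> 4 * \<mu>"
proof -
  have "lam * \<mu> / (lam + 2 * \<mu>) \<le> \<mu>"
    using denom_pos mu by (simp add: field_simps)
  then show ?thesis by (simp add: bulk_def)
qed

lemma W_split: "W S = \<mu> * (norm (dev (sym_part S)))\<^sup>2 + \<mu>c * (norm (skew_part S))\<^sup>2 + bulk * ((trace S)\<^sup>2 / 3)"
  by (simp add: W_shell_split bulk_def)

lemma W_lower: "min \<mu> (min \<mu>c bulk) * (norm S)\<^sup>2 \<le> W S"
  unfolding W_split by (rule weighted_lower) auto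

lemma min_weight_pos: "min \<mu> (min \<mu>c bulk) > 0"
  using mu muc bulk_pos by simp

lemma W_nonneg: "W S \<ge> 0"
  using W_lower[of S] min_weight_pos by (meson order_trans zero_le_mult_iff zero_le_power2 less_imp_le)

lemma W_eq_0_iff: "W S = 0 \<longleftrightarrow> S = 0"
proof
  assume "W S = 0"
  with W_lower[of S] have "min \<mu> (min \<mu>c bulk) * (norm S)\<^sup>2 \<le> 0" by simp
  with min_weight_pos show "S = 0"
    by (auto simp: mult_le_0_iff)
qed (simp add: W_shell_bilin_same[symmetric] bilinear_lzero[OF bilinear_W_shell])

lemma Wb_Cauchy_Schwarz: "\<bar>Wb S T\<bar> \<le> sqrt (W S) * sqrt (W T)"
proof (cases "T = 0")
  case True
  then show ?thesis by (simp add: bilinear_rzero[OF bilinear_W_shell] W_nonneg)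
next
  case False
  then have T: "W T > 0" using W_eq_0_iff W_nonneg[of T] by fastforce
  have "0 \<le> W (W T *\<^sub>R S + (- Wb S T) *\<^sub>R T)" by (rule W_nonneg)
  also have "\<dots> = W T * (W T * W S - (Wb S T)\<^sup>2)"
    unfolding W_shell_add W_shell_scale bilinear_lmul[OF bilinear_W_shell]
      bilinear_rmul[OF bilinear_W_shell]
    by (simp add: power2_eq_square algebra_simps)
  finally have "(Wb S T)\<^sup>2 \<le> W S * W T" using T by (simp add: zero_le_mult_iff mult.commute)
  then show ?thesis
    using real_sqrt_le_mono by (fastforce simp: real_sqrt_mult)
qed

section \<open>Coercivity from a curvature bound\<close>

lemma norm_mult_diag2:
  fixes S :: "real^3^3"
  assumes "\<bar>p\<bar> \<le> r" "\<bar>q\<bar> \<le> r"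
  shows "(norm (S ** diag2 p q))\<^sup>2 \<le> r\<^sup>2 * (norm S)\<^sup>2"
proof -
  have "p\<^sup>2 \<le> r\<^sup>2" "q\<^sup>2 \<le> r\<^sup>2" using assms by (simp_all add: abs_le_square_iff[symmetric])
  then have a: "(x * p)\<^sup>2 \<le> r\<^sup>2 * x\<^sup>2" "(x * q)\<^sup>2 \<le> r\<^sup>2 * x\<^sup>2" "0 \<le> r\<^sup>2 * x\<^sup>2" for x
    by (simp_all add: power_mult_distrib mult.commute mult_right_mono)
  have eq: "(norm (S ** diag2 p q))\<^sup>2 = (S$1$1 * p)\<^sup>2 + (S$1$2 * q)\<^sup>2 + (S$2$1 * p)\<^sup>2
      + (S$2$2 * q)\<^sup>2 + (S$3$1 * p)\<^sup>2 + (S$3$2 * q)\<^sup>2"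
    by (simp add: norm_sq_components diag2_def matrix_matrix_mult_def sum_3)
  show ?thesis
    unfolding eq norm_sq_components[of S] distrib_left
    using a(1)[of "S$1$1"] a(2)[of "S$1$2"] a(3)[of "S$1$3"] a(1)[of "S$2$1"] a(2)[of "S$2$2"]
      a(3)[of "S$2$3"] a(1)[of "S$3$1"] a(2)[of "S$3$2"] a(3)[of "S$3$3"]
    by linarith
qed

text \<open>With \<open>x\<close> and \<open>z\<close> the square roots of \<open>W E\<close> and
  \<open>W Z\<close>, the shell part is at least \<open>(1 - r\<^sup>2/12) x\<^sup>2 - (2 + \<rho>)
  r x z / 6 + z\<^sup>2/12\<close>. Completing the square in \<open>z\<close> uses up
  \<open>z\<^sup>2/12\<close> and costs
  \<open>(2 + \<rho>)\<^sup>2 r\<^sup>2 x\<^sup>2 / 12\<close>. In the sum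
  \<open>2 + \<rho>\<close>, the 2 comes from the mean curvature term and \<open>\<rho>\<close> from
  the term with \<open>Z B\<close>.\<close>

lemma coercive_small_curvature:
  assumes pq: "\<bar>p\<bar> \<le> r" "\<bar>q\<bar> \<le> r" and r: "r > 0"
    and lower: "\<And>S. c1 * (norm S)\<^sup>2 \<le> W S" and upper: "\<And>S. W S \<le> \<rho>\<^sup>2 * c1 * (norm S)\<^sup>2"
    and "\<rho> > 0" and curv: "\<And>S. W_curv \<mu> Lc b1 b2 b3 S \<ge> 0"
  shows "shell_energy \<mu> lam \<mu>c Lc b1 b2 b3 1 (diag2 p q) C (p * q) ((p + q) / 2) E K
    \<ge> (1 - r\<^sup>2 * (1 + (2 + \<rho>)\<^sup>2) / 12) * W E + (1 - r\<^sup>2 / 12) * W_curv \<mu> Lc b1 b2 b3 K"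
proof -
  define Z where "Z = E ** diag2 p q + C ** K"
  define x where "x = sqrt (W E)"
  define z where "z = sqrt (W Z)"
  have x: "W E = x\<^sup>2" "x \<ge> 0" and z: "W Z = z\<^sup>2" "z \<ge> 0"
    by (simp_all add: x_def z_def W_nonneg)
  have "\<bar>p * q\<bar> \<le> r * r" unfolding abs_mult using pq by (intro mult_mono) auto
  then have G: "\<bar>p * q\<bar> \<le> r\<^sup>2" by (simp add: power2_eq_square)
  \<comment> \<open>Passing from \<open>W\<close> to the Frobenius norm and back costs the factor
    \<open>\<rho>\<^sup>2\<close>, the curvature bound costs \<open>r\<^sup>2\<close>.\<close>
  have "W (Z ** diag2 p q) \<le> \<rho>\<^sup>2 * r\<^sup>2 * W Z"
  proof (cases "c1 \<ge> 0")
    case True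
    have "W (Z ** diag2 p q) \<le> \<rho>\<^sup>2 * c1 * (norm (Z ** diag2 p q))\<^sup>2" by (rule upper)
    also have "\<dots> \<le> \<rho>\<^sup>2 * c1 * (r\<^sup>2 * (norm Z)\<^sup>2)"
      using True by (intro mult_left_mono norm_mult_diag2[OF pq]) simp
    also have "\<dots> = \<rho>\<^sup>2 * r\<^sup>2 * (c1 * (norm Z)\<^sup>2)" by simp
    also have "\<dots> \<le> \<rho>\<^sup>2 * r\<^sup>2 * W Z" by (intro mult_left_mono lower) simp
    finally show ?thesis .
  next
    case False
    then have "\<rho>\<^sup>2 * c1 * (norm (Z ** diag2 p q))\<^sup>2 \<le> 0"
      by (simp add: mult_nonneg_nonpos mult_nonpos_nonneg)
    then show ?thesis using upper[of "Z ** diag2 p q"] W_nonneg[of Z]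
      by (meson order_trans mult_nonneg_nonneg zero_le_power2)
  qed
  then have "W (Z ** diag2 p q) \<le> (\<rho> * r * z)\<^sup>2" by (simp add: z power_mult_distrib)
  then have "sqrt (W (Z ** diag2 p q)) \<le> \<rho> * r * z"
    using \<open>\<rho> > 0\<close> r z by (intro real_le_lsqrt) (auto simp: W_nonneg)
  then have "x * sqrt (W (Z ** diag2 p q)) \<le> x * (\<rho> * r * z)"
    using x by (intro mult_left_mono)
  with Wb_Cauchy_Schwarz[of E "Z ** diag2 p q"]
  have ZB: "Wb E (Z ** diag2 p q) \<ge> - (x * (\<rho> * r * z))"
    by (simp add: x_def)
  have "\<bar>p + q\<bar> \<le> 2 * r" using pq by linarith
  moreover have "\<bar>Wb E Z\<bar> \<le> x * z" using Wb_Cauchy_Schwarz[of E Z] by (simp add: x_def z_def)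
  ultimately have "\<bar>(p + q) * Wb E Z\<bar> \<le> 2 * r * (x * z)"
    unfolding abs_mult using r by (intro mult_mono) auto
  then have HZ: "(p + q) * Wb E Z \<le> 2 * r * (x * z)" by linarith
  have sq: "0 \<le> (z - (2 + \<rho>) * r * x)\<^sup>2" by simp
  have g1: "- (r\<^sup>2) * x\<^sup>2 \<le> p * q * x\<^sup>2"
    using G by (intro mult_right_mono) auto
  have g2: "(1 - r\<^sup>2 / 12) * W_curv \<mu> Lc b1 b2 b3 K \<le> (1 - p * q / 12) * W_curv \<mu> Lc b1 b2 b3 K"
    using G curv by (intro mult_right_mono) auto
  have "shell_energy \<mu> lam \<mu>c Lc b1 b2 b3 1 (diag2 p q) C (p * q) ((p + q) / 2) E K
    = x\<^sup>2 + p * q * x\<^sup>2 / 12 + z\<^sup>2 / 12 - (p + q) * Wb E Z / 6 + Wb E (Z ** diag2 p q) / 6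
      + (1 - p * q / 12) * W_curv \<mu> Lc b1 b2 b3 K + W_curv \<mu> Lc b1 b2 b3 (K ** diag2 p q) / 12"
    unfolding shell_energy_def Z_def[symmetric] by (simp add: x z algebra_simps)
  moreover have "(1 - r\<^sup>2 * (1 + (2 + \<rho>)\<^sup>2) / 12) * W E
      = x\<^sup>2 - r\<^sup>2 * x\<^sup>2 / 12 + z\<^sup>2/12 - 2 * r * (x * z) / 6 - x * (\<rho> * r * z) / 6
         - (z - (2 + \<rho>) * r * x)\<^sup>2 / 12"
    by (simp add: x power2_eq_square algebra_simps add_divide_distrib diff_divide_distrib)
  ultimately show ?thesis using g1 g2 ZB HZ sq curv[of "K ** diag2 p q"] by linarith
qed

text \<open>The factor 3 is Cauchy-Schwarz for three summands. The bound 1/4 is meant for a product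
  of two curvatures, 1/2 for a single one.\<close>

lemma sum3_sq_bound:
  fixes a b c u v w :: real
  assumes "\<bar>a\<bar> \<le> 1/4" "\<bar>b\<bar> \<le> 1/2" "\<bar>c\<bar> \<le> 1/2"
  shows "(a * u + b * v + c * w)\<^sup>2 \<le> 3 * (u\<^sup>2 / 16 + v\<^sup>2 / 4 + w\<^sup>2 / 4)"
proof -
  have "\<bar>a\<bar>\<^sup>2 \<le> (1/4)\<^sup>2" "\<bar>b\<bar>\<^sup>2 \<le> (1/2)\<^sup>2" "\<bar>c\<bar>\<^sup>2 \<le> (1/2)\<^sup>2"
    using assms by (intro power_mono; simp)+
  then have "(a * u)\<^sup>2 \<le> u\<^sup>2 / 16" "(b * v)\<^sup>2 \<le> v\<^sup>2 / 4" "(c * w)\<^sup>2 \<le> w\<^sup>2 / 4"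
    using mult_right_mono[of "a\<^sup>2" "1/16" "u\<^sup>2"] mult_right_mono[of "b\<^sup>2" "1/4" "v\<^sup>2"]
      mult_right_mono[of "c\<^sup>2" "1/4" "w\<^sup>2"]
    by (simp_all add: power2_eq_square mult_ac)
  moreover have "(x + y + z)\<^sup>2 \<le> 3 * (x\<^sup>2 + y\<^sup>2 + z\<^sup>2)" for x y z :: real
  proof -
    have "(x + y + z)\<^sup>2 = 3 * (x\<^sup>2 + y\<^sup>2 + z\<^sup>2) - ((x - y)\<^sup>2 + (y - z)\<^sup>2 + (x - z)\<^sup>2)"
      by (simp add: power2_eq_square algebra_simps)
    moreover have "0 \<le> (x - y)\<^sup>2 + (y - z)\<^sup>2 + (x - z)\<^sup>2" by simp
    ultimately show ?thesis by linarith
  qed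
  ultimately show ?thesis by (smt (verit, best))
qed

text \<open>The orthogonal projector onto the normal in the principal frame;
  \<open>mat 1 - proj3\<close> is the identity of the tangent plane.\<close>

definition proj3 :: "real^3^3" where "proj3 = vector [vector [0,0,0], vector [0,0,0], vector [0,0,1]]"

text \<open>The column \<open>E ** proj3\<close> alone is not bounded by \<open>W E\<close> with a constant that depends only on
  \<open>C1\<close>. Multiplied by the Gauss curvature it is: \<open>E$1$3\<close> differs from \<open>\<plusminus> E$3$1\<close> by a symmetric or
  skew entry of \<open>E\<close>, and \<open>p * q * E$3$1 = q * Z$3$1\<close>.\<close>

lemma W_normal_column_bound:
  assumes p: "\<bar>p\<bar> \<le> 1/2" and q: "\<bar>q\<bar> \<le> 1/2"
    and C1: "\<mu> \<le> C1" "\<mu>c \<le> C1"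
    and Z: "Z = E ** diag2 p q + J12 ** K"
  shows "W ((p * q) *\<^sub>R (E ** proj3))
    \<le> 3/4 * W E + 3 * W Z + C1 * (3/2 * (K$2$1)\<^sup>2 + 3/4 * ((K$1$3)\<^sup>2 + (K$2$3)\<^sup>2))"
proof -
  define k where "k = p * q"
  have "\<bar>p * q\<bar> \<le> 1/2 * (1/2)" unfolding abs_mult using p q by (intro mult_mono) auto
  then have k: "\<bar>k\<bar> \<le> 1/4" by (simp add: k_def)
  have Zc: "Z$1$1 = p * E$1$1 + K$2$1" "Z$1$3 = K$2$3" "Z$2$3 = - K$1$3"
    "Z$3$1 = p * E$3$1" "Z$3$2 = q * E$3$2" "Z$3$3 = 0"
    by (simp_all add: Z diag2_def J12_def matrix_matrix_mult_def sum_3)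
  \<comment> \<open>\<open>E$3$3\<close> is reached from \<open>E$1$1\<close> through the diagonal
    gap seen by the deviator, and \<open>p * E$1$1 = Z$1$1 - K$2$1\<close>.\<close>
  have e33: "(k * E$3$3)\<^sup>2 \<le> 3 * ((E$1$1 - E$3$3)\<^sup>2/16 + (Z$1$1)\<^sup>2/4 + (K$2$1)\<^sup>2/4)"
    using sum3_sq_bound[of "-k" q "-q" "E$1$1 - E$3$3" "Z$1$1" "K$2$1"] k q
    by (simp add: Zc k_def algebra_simps)
  \<comment> \<open>Each shear entry is estimated twice: the symmetric version is charged to
    \<open>\<mu>\<close> and the antisymmetric one to \<open>\<mu>c\<close>, so the ratio of the two
    coefficients never enters.\<close>
  have e13: "(k * E$1$3)\<^sup>2 \<le> 3 * ((E$1$3 + E$3$1)\<^sup>2/16 + (Z$1$3 + Z$3$1)\<^sup>2/4 + (K$2$3)\<^sup>2/4)"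
    using sum3_sq_bound[of k "-q" q "E$1$3 + E$3$1" "Z$1$3 + Z$3$1" "K$2$3"] k q
    by (simp add: Zc k_def algebra_simps)
  have e13': "(k * E$1$3)\<^sup>2 \<le> 3 * ((E$1$3 - E$3$1)\<^sup>2/16 + (Z$1$3 - Z$3$1)\<^sup>2/4 + (K$2$3)\<^sup>2/4)"
    using sum3_sq_bound[of k "-q" q "E$1$3 - E$3$1" "Z$1$3 - Z$3$1" "K$2$3"] k q
    by (simp add: Zc k_def algebra_simps)
  have e23: "(k * E$2$3)\<^sup>2 \<le> 3 * ((E$2$3 + E$3$2)\<^sup>2/16 + (Z$2$3 + Z$3$2)\<^sup>2/4 + (K$1$3)\<^sup>2/4)"
    using sum3_sq_bound[of k "-p" "-p" "E$2$3 + E$3$2" "Z$2$3 + Z$3$2" "K$1$3"] k p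
    by (simp add: Zc k_def algebra_simps)
  have e23': "(k * E$2$3)\<^sup>2 \<le> 3 * ((E$2$3 - E$3$2)\<^sup>2/16 + (Z$2$3 - Z$3$2)\<^sup>2/4 + (K$1$3)\<^sup>2/4)"
    using sum3_sq_bound[of k "-p" "-p" "E$2$3 - E$3$2" "Z$2$3 - Z$3$2" "K$1$3"] k p
    by (simp add: Zc k_def algebra_simps)
  let ?d = "\<lambda>S. (norm (dev (sym_part S)))\<^sup>2" and ?s = "\<lambda>S. (norm (skew_part S))\<^sup>2"
  have gap: "(a - c)\<^sup>2 / 2 \<le> ((a - b)\<^sup>2 + (b - c)\<^sup>2 + (a - c)\<^sup>2) / 3" for a b c :: real
  proof -
    have "((a - b)\<^sup>2 + (b - c)\<^sup>2 + (a - c)\<^sup>2) / 3 - (a - c)\<^sup>2 / 2 = (a + c - 2 * b)\<^sup>2 / 6"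
      by (simp add: power2_eq_square field_simps)
    then show ?thesis by (metis diff_ge_0_iff_ge divide_nonneg_pos zero_le_power2 zero_less_numeral)
  qed
  have d: "(S$1$1 - S$3$3)\<^sup>2/2 + (S$1$3 + S$3$1)\<^sup>2/2 + (S$2$3 + S$3$2)\<^sup>2/2 \<le> ?d S" for S
    unfolding norm_dev_sym_components using gap[of "S$1$1" "S$3$3" "S$2$2"]
      zero_le_power2[of "S$1$2 + S$2$1"] by argo
  have s: "(S$1$3 - S$3$1)\<^sup>2/2 + (S$2$3 - S$3$2)\<^sup>2/2 \<le> ?s S" for S
    unfolding norm_skew_components by (simp add: add_divide_distrib)
  have W_ge: "\<mu> * ?d S + \<mu>c * ?s S \<le> W S" for S
    unfolding W_split using bulk_pos by simp
  have "W (k *\<^sub>R (E ** proj3)) = \<mu> * (2/3 * (k * E$3$3)\<^sup>2 + ((k * E$1$3)\<^sup>2 + (k * E$2$3)\<^sup>2)/2)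
      + \<mu>c * (((k * E$1$3)\<^sup>2 + (k * E$2$3)\<^sup>2)/2) + bulk * ((k * E$3$3)\<^sup>2 / 3)"
    unfolding W_split norm_dev_sym_components norm_skew_components
    by (simp add: proj3_def matrix_matrix_mult_def sum_3 trace_def)
  also have "\<dots> \<le> \<mu> * (2/3 * (k * E$3$3)\<^sup>2 + ((k * E$1$3)\<^sup>2 + (k * E$2$3)\<^sup>2)/2)
      + \<mu>c * (((k * E$1$3)\<^sup>2 + (k * E$2$3)\<^sup>2)/2) + 4 * \<mu> * ((k * E$3$3)\<^sup>2 / 3)"
    by (intro add_left_mono mult_right_mono bulk_le) simp
  also have "\<dots> = \<mu> * (2 * (k * E$3$3)\<^sup>2 + ((k * E$1$3)\<^sup>2 + (k * E$2$3)\<^sup>2)/2)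
      + \<mu>c * (((k * E$1$3)\<^sup>2 + (k * E$2$3)\<^sup>2)/2)"
    by (simp add: algebra_simps)
  \<comment> \<open>The coefficients 3/4 and 3 are dictated by the entry \<open>E$3$3\<close>, whose
    weight 2 meets the factor 3 of \<open>e33\<close>; the shear entries leave slack.\<close>
  also have "\<dots> \<le> \<mu> * (3/4 * ?d E + 3 * ?d Z + (3/2 * (K$2$1)\<^sup>2 + 3/8 * ((K$1$3)\<^sup>2 + (K$2$3)\<^sup>2)))
      + \<mu>c * (3/4 * ?s E + 3 * ?s Z + 3/8 * ((K$1$3)\<^sup>2 + (K$2$3)\<^sup>2))"
  proof (rule add_mono; rule mult_left_mono)
    show "2 * (k * E$3$3)\<^sup>2 + ((k * E$1$3)\<^sup>2 + (k * E$2$3)\<^sup>2)/2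
        \<le> 3/4 * ?d E + 3 * ?d Z + (3/2 * (K$2$1)\<^sup>2 + 3/8 * ((K$1$3)\<^sup>2 + (K$2$3)\<^sup>2))"
      using e33 e13 e23 d[of E] d[of Z] zero_le_power2[of "E$1$3 + E$3$1"]
        zero_le_power2[of "E$2$3 + E$3$2"] zero_le_power2[of "Z$1$3 + Z$3$1"]
        zero_le_power2[of "Z$2$3 + Z$3$2"] unfolding \<open>Z$3$3 = 0\<close> diff_zero by argo
    show "((k * E$1$3)\<^sup>2 + (k * E$2$3)\<^sup>2)/2
        \<le> 3/4 * ?s E + 3 * ?s Z + 3/8 * ((K$1$3)\<^sup>2 + (K$2$3)\<^sup>2)"
      using e13' e23' s[of E] s[of Z] zero_le_power2[of "E$1$3 - E$3$1"]
        zero_le_power2[of "E$2$3 - E$3$2"] zero_le_power2[of "Z$1$3 - Z$3$1"]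
        zero_le_power2[of "Z$2$3 - Z$3$2"] by argo
  qed (use mu muc in auto)
  also have "\<dots> = 3/4 * (\<mu> * ?d E + \<mu>c * ?s E) + 3 * (\<mu> * ?d Z + \<mu>c * ?s Z)
      + (\<mu> * (3/2 * (K$2$1)\<^sup>2 + 3/8 * ((K$1$3)\<^sup>2 + (K$2$3)\<^sup>2)) + \<mu>c * (3/8 * ((K$1$3)\<^sup>2 + (K$2$3)\<^sup>2)))"
    by (simp add: algebra_simps)
  also have "\<dots> \<le> 3/4 * W E + 3 * W Z
      + (C1 * (3/2 * (K$2$1)\<^sup>2 + 3/8 * ((K$1$3)\<^sup>2 + (K$2$3)\<^sup>2)) + C1 * (3/8 * ((K$1$3)\<^sup>2 + (K$2$3)\<^sup>2)))"
    by (intro add_mono mult_left_mono mult_right_mono W_ge C1) auto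
  finally show ?thesis by (simp add: k_def algebra_simps)
qed

text \<open>By Cayley-Hamilton \<open>B\<^sup>2 = (p + q) B - p q (1 - proj3)\<close>, so the mixed terms of the energy reduce to
  \<open>- p q W(E) + Wb(E, Y)\<close> in which \<open>E\<close> enters \<open>Y\<close> only through its normal column. Condition ii)
  needs no such cancellation.\<close>

lemma coercive_small_thickness:
  assumes p: "\<bar>p\<bar> \<le> 1/2" and q: "\<bar>q\<bar> \<le> 1/2"
    and C1: "\<mu> \<le> C1" "\<mu>c \<le> C1" and upper: "\<And>S. W S \<le> C1 * (norm S)\<^sup>2"
    and curv: "\<And>S. C1 * (norm S)\<^sup>2 \<le> 16 * W_curv \<mu> Lc b1 b2 b3 S"
  shows "shell_energy \<mu> lam \<mu>c Lc b1 b2 b3 1 (diag2 p q) J12 (p * q) ((p + q) / 2) E K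
    \<ge> 1/5 * (W E + W_curv \<mu> Lc b1 b2 b3 K)"
proof -
  have C1_pos: "C1 > 0" using C1 mu by linarith
  define B where "B = diag2 p q"
  define Z where "Z = E ** B + J12 ** K"
  define Y1 where "Y1 = (p * q) *\<^sub>R (E ** proj3)"
  define Y2 where "Y2 = J12 ** K ** B - (p + q) *\<^sub>R (J12 ** K)"
  let ?V = "W_curv \<mu> Lc b1 b2 b3"
  \<comment> \<open>The multiple \<open>(p + q) *\<^sub>R Z\<close> cancels the mean curvature term,
    because \<open>1/3 * H = (p + q) / 6\<close> matches the factor \<open>1/6\<close> in front of
    \<open>Wb E (Z ** B)\<close>.\<close>
  have CH: "Z ** B = (p + q) *\<^sub>R Z + ((- (p * q)) *\<^sub>R E + (Y1 + Y2))"
    unfolding Z_def Y1_def Y2_def B_def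
    by (simp add: diag2_def J12_def proj3_def matrix_matrix_mult_def vec_eq_iff forall_3 sum_3 algebra_simps)
  have "\<bar>p + q\<bar> \<le> 1" using p q by linarith
  then have sq: "p\<^sup>2 \<le> 1/4" "q\<^sup>2 \<le> 1/4" "(p + q)\<^sup>2 \<le> 1"
    using power_mono[OF p, of 2] power_mono[OF q, of 2]
    by (simp_all add: power_divide abs_square_le_1)
  have Y2: "W Y2 \<le> C1 * (1/4 * ((K$1$1)\<^sup>2 + (K$1$2)\<^sup>2 + (K$2$1)\<^sup>2 + (K$2$2)\<^sup>2) + ((K$1$3)\<^sup>2 + (K$2$3)\<^sup>2))"
  proof -
    \<comment> \<open>\<open>B - (p + q)\<close> is diagonal with entries \<open>-q\<close>,
      \<open>-p\<close>, \<open>-(p + q)\<close>, while \<open>J12\<close> exchanges the first two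
      rows of \<open>K\<close> up to sign and deletes the third.\<close>
    have "(norm Y2)\<^sup>2 = q\<^sup>2 * (K$1$1)\<^sup>2 + p\<^sup>2 * (K$1$2)\<^sup>2 + q\<^sup>2 * (K$2$1)\<^sup>2 + p\<^sup>2 * (K$2$2)\<^sup>2
        + ((p+q)\<^sup>2 * (K$1$3)\<^sup>2 + (p+q)\<^sup>2 * (K$2$3)\<^sup>2)"
      unfolding norm_sq_components
      by (simp add: Y2_def B_def diag2_def J12_def matrix_matrix_mult_def sum_3 power2_eq_square
          algebra_simps)
    also have "\<dots> \<le> 1/4 * (K$1$1)\<^sup>2 + 1/4 * (K$1$2)\<^sup>2 + 1/4 * (K$2$1)\<^sup>2 + 1/4 * (K$2$2)\<^sup>2
        + (1 * (K$1$3)\<^sup>2 + 1 * (K$2$3)\<^sup>2)"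
      by (intro add_mono mult_right_mono sq) auto
    finally have "C1 * (norm Y2)\<^sup>2 \<le> C1 * \<dots>" using C1_pos by (intro mult_left_mono) auto
    with upper[of Y2] show ?thesis by (simp add: algebra_simps)
  qed
  have Y1: "W Y1 \<le> 3/4 * W E + 3 * W Z + C1 * (3/2 * (K$2$1)\<^sup>2 + 3/4 * ((K$1$3)\<^sup>2 + (K$2$3)\<^sup>2))"
    unfolding Y1_def using W_normal_column_bound[OF p q C1 Z_def[unfolded B_def]] by (simp add: B_def)
  \<comment> \<open>Parallelogram law for \<open>W\<close>.\<close>
  have "W (Y1 + Y2) + W (Y1 + (-1) *\<^sub>R Y2) = 2 * W Y1 + 2 * W Y2"
    unfolding W_shell_add W_shell_scale bilinear_rmul[OF bilinear_W_shell] by simp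
  then have "W (Y1 + Y2) \<le> 2 * W Y1 + 2 * W Y2" using W_nonneg[of "Y1 + (-1) *\<^sub>R Y2"] by linarith
  also have "\<dots> \<le> 3/2 * W E + 6 * W Z
      + (2 * (C1 * (3/2 * (K$2$1)\<^sup>2 + 3/4 * ((K$1$3)\<^sup>2 + (K$2$3)\<^sup>2))
         + C1 * (1/4 * ((K$1$1)\<^sup>2 + (K$1$2)\<^sup>2 + (K$2$1)\<^sup>2 + (K$2$2)\<^sup>2) + ((K$1$3)\<^sup>2 + (K$2$3)\<^sup>2))))"
    using Y1 Y2 by argo
  also have "\<dots> = 3/2 * W E + 6 * W Z
      + C1 * (7/2 * (K$2$1)\<^sup>2 + 7/2 * ((K$1$3)\<^sup>2 + (K$2$3)\<^sup>2) + 1/2 * ((K$1$1)\<^sup>2 + (K$1$2)\<^sup>2 + (K$2$2)\<^sup>2))"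
    by (simp add: algebra_simps)
  also have "\<dots> \<le> 3/2 * W E + 6 * W Z + C1 * (7/2 * (norm K)\<^sup>2)"
  proof (rule add_left_mono, rule mult_left_mono)
    have "0 \<le> (K$i$j)\<^sup>2" for i j by simp
    from this[of 1 1] this[of 1 2] this[of 2 2] this[of 3 1] this[of 3 2] this[of 3 3]
    show "7/2 * (K$2$1)\<^sup>2 + 7/2 * ((K$1$3)\<^sup>2 + (K$2$3)\<^sup>2) + 1/2 * ((K$1$1)\<^sup>2 + (K$1$2)\<^sup>2 + (K$2$2)\<^sup>2)
        \<le> 7/2 * (norm K)\<^sup>2"
      unfolding norm_sq_components by argo
  qed (use C1_pos in simp)
  also have "\<dots> \<le> 3/2 * W E + 6 * W Z + 56 * ?V K"
    using curv[of K] by simp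
  finally have Y: "W (Y1 + Y2) \<le> 3/2 * W E + 6 * W Z + 56 * ?V K" .
  \<comment> \<open>Young's inequality with weight 6, chosen so that the loss \<open>6/72\<close> of
    \<open>W Z\<close> exactly uses up the available \<open>1/12\<close>. The loss
    \<open>56/72\<close> of \<open>?V K\<close>, with \<open>1/48\<close> for the Gauss curvature
    term, leaves \<open>29/144 > 1/5\<close>; for \<open>W E\<close> there remains
    \<open>22/48\<close>.\<close>
  have "0 \<le> W (6 *\<^sub>R E + (Y1 + Y2))" by (rule W_nonneg)
  also have "\<dots> = 36 * W E + 12 * Wb E (Y1 + Y2) + W (Y1 + Y2)"
    unfolding W_shell_add[of _ _ _ "6 *\<^sub>R E"] W_shell_scale bilinear_lmul[OF bilinear_W_shell] by simp
  finally have EY: "Wb E (Y1 + Y2) \<ge> - 3 * W E - W (Y1 + Y2) / 12" by simp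
  have V: "?V S \<ge> 0" for S
    using curv[of S] C1_pos by (meson mult_nonneg_nonneg order_trans zero_le_power2 less_imp_le
        zero_le_mult_iff zero_less_numeral not_less)
  have "\<bar>p * q\<bar> \<le> 1/2 * (1/2)" unfolding abs_mult using p q by (intro mult_mono) auto
  then have k: "p * q * W E \<le> 1/4 * W E" "p * q * ?V K \<le> 1/4 * ?V K"
    using W_nonneg V by (intro mult_right_mono; simp)+
  have "shell_energy \<mu> lam \<mu>c Lc b1 b2 b3 1 B J12 (p * q) ((p + q) / 2) E K
    = W E + p * q * W E / 12 + W Z / 12 - (p + q) * Wb E Z / 6 + Wb E (Z ** B) / 6
      + ?V K - p * q * ?V K / 12 + ?V (K ** B) / 12"
    unfolding shell_energy_def Z_def[symmetric] by (simp add: algebra_simps)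
  also have "Wb E (Z ** B) = (p + q) * Wb E Z - p * q * W E + Wb E (Y1 + Y2)"
    unfolding CH by (simp only: bilinear_radd[OF bilinear_W_shell, of _ _ _ E "_ *\<^sub>R _"]
        bilinear_rmul[OF bilinear_W_shell] W_shell_bilin_same) simp
  finally show ?thesis using EY Y k V[of K] V[of "K ** B"] W_nonneg[of E]
    unfolding B_def by argo
qed

end


section \<open>Second derivative and orthogonal invariance of the energy\<close>

text \<open>The differential at \<open>q\<close> in direction \<open>u\<close> is
  \<open>b q u + b u q\<close>, again linear in \<open>q\<close>, so differentiating once more gives
  \<open>2 * b u u\<close> at every base point. This form fits the energy, whose mixed terms are
  naturally represented by a non-symmetric \<open>b\<close>.\<close>

lemma D2_quadratic:
  fixes b :: "'a::euclidean_space \<Rightarrow> 'a \<Rightarrow> real"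
  assumes "bilinear b" and f: "\<And>q. f q = b q q"
  shows "D2 f p u u = 2 * f u"
proof -
  have bb: "bounded_bilinear b"
    using assms(1) by (simp add: bilinear_conv_bounded_bilinear)
  interpret bounded_bilinear b by (rule bb)
  have der: "(f has_derivative (\<lambda>v. b q v + b v q)) (at q)" for q
    unfolding f[abs_def] by (rule FDERIV) (rule has_derivative_ident)+
  then have D: "frechet_derivative f (at q) u = b q u + b u q" for q
    using fun_cong[OF frechet_derivative_at[OF der[of q]], of u] by simp
  have der2: "((\<lambda>q. b q u + b u q) has_derivative (\<lambda>v. b v u + b u v)) (at p)"
    by (intro has_derivative_add bounded_linear.has_derivative[OF bounded_linear_left]
        bounded_linear.has_derivative[OF bounded_linear_right] has_derivative_ident)
  then show ?thesis
    by (simp add: D2_def D f fun_cong[OF frechet_derivative_at[OF der2], of u, symmetric])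
qed

lemma matrix_add_rdistrib: "(A + B) ** C = A ** C + B ** C" for A B :: "real^'n^'m"
  by (simp add: matrix_matrix_mult_def vec_eq_iff sum.distrib algebra_simps)

lemma D2_shell_energy:
  "D2 (\<lambda>(E, K). shell_energy \<mu> lam \<mu>c Lc b1 b2 b3 h B C G H E K) p (E, K) (E, K)
    = 2 * shell_energy \<mu> lam \<mu>c Lc b1 b2 b3 h B C G H E K"
proof -
  let ?S = "W_shell_bilin \<mu> lam \<mu>c" and ?V = "W_curv_bilin \<mu> Lc b1 b2 b3"
  define Z where "Z p = fst p ** B + C ** snd p" for p
  define b where "b p q = (h + G * h^3 / 12) * ?S (fst p) (fst q) + h^3 / 12 * ?S (Z p) (Z q)
     - h^3 / 3 * H * ?S (fst p) (Z q) + h^3 / 6 * ?S (fst p) (Z q ** B)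
     + (h - G * h^3 / 12) * ?V (snd p) (snd q) + h^3 / 12 * ?V (snd p ** B) (snd q ** B)" for p q
  have Zlin: "Z (p + q) = Z p + Z q" "Z (r *\<^sub>R p) = r *\<^sub>R Z p" for p q r
    by (simp_all add: Z_def matrix_add_rdistrib matrix_add_ldistrib matrix_mult_scaleR scaleR_add_right)
  have bil: "bilinear b"
    unfolding bilinear_def b_def
    by (intro conjI allI linearI; unfold Zlin fst_add snd_add fst_scaleR snd_scaleR
        matrix_add_rdistrib matrix_mult_scaleR(1)
        bilinear_ladd[OF bilinear_W_shell] bilinear_radd[OF bilinear_W_shell]
        bilinear_ladd[OF bilinear_W_curv] bilinear_radd[OF bilinear_W_curv]
        bilinear_lmul[OF bilinear_W_shell] bilinear_rmul[OF bilinear_W_shell]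
        bilinear_lmul[OF bilinear_W_curv] bilinear_rmul[OF bilinear_W_curv])
      (simp_all add: algebra_simps add_divide_distrib)
  have eq: "(\<lambda>(E, K). shell_energy \<mu> lam \<mu>c Lc b1 b2 b3 h B C G H E K) q = b q q" for q
    by (simp add: b_def Z_def shell_energy_def W_shell_bilin_same W_curv_bilin_same split_beta)
  show ?thesis using D2_quadratic[OF bil eq, of p "(E, K)"] by simp
qed

section \<open>Change of orthonormal frame, with the new basis in the columns of
  \<open>R\<close>\<close>

definition rotate :: "real^3^3 \<Rightarrow> real^3^3 \<Rightarrow> real^3^3" where
  "rotate R X = transpose R ** X ** R"

lemma linear_rotate: "linear (rotate R)"
  by (rule linearI) (simp_all add: rotate_def matrix_add_rdistrib matrix_add_ldistrib matrix_mult_scaleR)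

lemmas rotate_linear = linear_add[OF linear_rotate] linear_diff[OF linear_rotate]
  linear_cmul[OF linear_rotate]

lemma rotate_transpose: "rotate R (transpose X) = transpose (rotate R X)"
  by (simp add: rotate_def matrix_transpose_mul transpose_transpose matrix_mul_assoc)

context
  fixes R :: "real^3^3"
  assumes R: "orthogonal_matrix R"
begin

lemma RR: "transpose R ** R = mat 1" "R ** transpose R = mat 1"
  using R by (auto simp: orthogonal_matrix_def)

lemma rotate_mult: "rotate R (X ** Y) = rotate R X ** rotate R Y"
  unfolding rotate_def matrix_mul_assoc
  by (simp add: matrix_mul_assoc[symmetric] RR)

lemma rotate_trace: "trace (rotate R X) = trace X"
  unfolding rotate_def trace_mul_sym[of _ R] matrix_mul_assoc by (simp add: RR)

lemma rotate_inner: "rotate R X \<bullet> rotate R Y = X \<bullet> Y"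
  unfolding inner_eq_trace rotate_transpose[symmetric] rotate_mult[symmetric] rotate_trace ..

lemma rotate_mat1: "rotate R (mat 1) = mat 1"
  by (simp add: rotate_def RR)

lemma rotate_norm: "norm (rotate R X) = norm X"
  by (simp add: norm_eq_sqrt_inner rotate_inner)

lemma rotate_parts:
  "sym_part (rotate R X) = rotate R (sym_part X)"
  "skew_part (rotate R X) = rotate R (skew_part X)"
  "dev (rotate R X) = rotate R (dev X)"
  by (simp_all add: sym_part_def skew_part_def dev_def rotate_linear rotate_transpose rotate_trace
      rotate_mat1)

text \<open>Conjugation by an orthogonal matrix respects products, transposes, linear combinations,
  traces and Frobenius products, and the energy is built from these.\<close>

lemma rotate_shell_energy:
  "shell_energy \<mu> lam \<mu>c Lc b1 b2 b3 h B C G H E K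
    = shell_energy \<mu> lam \<mu>c Lc b1 b2 b3 h (rotate R B) (rotate R C) G H (rotate R E) (rotate R K)"
  unfolding shell_energy_def rotate_mult[symmetric] rotate_linear[symmetric]
    W_shell_def W_shell_bilin_def W_curv_def rotate_parts rotate_inner rotate_trace rotate_norm ..

end


section \<open>The principal frame of the midsurface\<close>

text \<open>The mean value theorem along \<open>u\<close>, applied to the increment of
  \<open>g\<close> over \<open>t *\<^sub>R v\<close>, turns the second difference into
  \<open>t\<close> times a difference of first derivatives. Both of these are linearised at
  \<open>x\<close>, where the derivative is differentiable; the two errors
  \<open>e' * (t * M)\<close> add up to \<open>e * t\<close>.\<close>

lemma second_difference:
  fixes g :: "'a::real_normed_vector \<Rightarrow> real"
  assumes S: "open S" "x \<in> S" and g: "\<And>y. y \<in> S \<Longrightarrow> (g has_derivative g' y) (at y)"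
    and D: "((\<lambda>y. g' y u) has_derivative D) (at x)" and e: "e > 0"
  shows "\<exists>d>0. \<forall>t. 0 < t \<and> t < d \<longrightarrow>
    \<bar>g (x + t *\<^sub>R u + t *\<^sub>R v) - g (x + t *\<^sub>R u) - g (x + t *\<^sub>R v) + g x - t\<^sup>2 * D v\<bar> \<le> e * t\<^sup>2"
proof -
  interpret D: bounded_linear D by (rule has_derivative_bounded_linear[OF D])
  define M where "M = norm u + norm v + 1"
  have M: "M > 0" by (simp add: M_def add_nonneg_pos)
  define e' where "e' = e / (2 * M)"
  have e': "e' > 0" using e M by (simp add: e'_def)
  obtain d1 where d1: "d1 > 0" "\<And>y. norm (y - x) < d1 \<Longrightarrow>
      \<bar>g' y u - g' x u - D (y - x)\<bar> \<le> e' * norm (y - x)"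
    using D e' unfolding has_derivative_at_alt by fastforce
  obtain d2 where d2: "d2 > 0" "ball x d2 \<subseteq> S" using S openE by blast
  define d where "d = min d1 d2 / M"
  have "d > 0" using d1 d2 M by (simp add: d_def)
  moreover have "\<bar>g (x + t *\<^sub>R u + t *\<^sub>R v) - g (x + t *\<^sub>R u) - g (x + t *\<^sub>R v) + g x - t\<^sup>2 * D v\<bar> \<le> e * t\<^sup>2"
    if t: "0 < t" "t < d" for t
  proof -
    have tM: "t * M < d1" "t * M < d2" using t M by (auto simp: d_def field_simps)
    have small: "norm ((s * t) *\<^sub>R u + r *\<^sub>R v) \<le> t * M" if "s \<in> {0..1}" "r \<in> {0, t}" for s r
    proof -
      have "norm ((s * t) *\<^sub>R u) \<le> t * norm u"
        using that t by (simp add: abs_mult mult_left_le_one_le mult_right_mono)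
      moreover have "norm (r *\<^sub>R v) \<le> t * norm v" using that t by auto
      ultimately have "norm ((s * t) *\<^sub>R u + r *\<^sub>R v) \<le> t * norm u + t * norm v"
        by (meson add_mono norm_triangle_le)
      also have "\<dots> \<le> t * M" using t by (simp add: M_def algebra_simps)
      finally show ?thesis .
    qed
    have inS: "x + ((s * t) *\<^sub>R u + r *\<^sub>R v) \<in> S" if "s \<in> {0..1}" "r \<in> {0, t}" for s r
    proof -
      have "x + ((s * t) *\<^sub>R u + r *\<^sub>R v) \<in> ball x d2"
        using small[OF that] tM dist_add_cancel[of x 0 "(s * t) *\<^sub>R u + r *\<^sub>R v"] by simp
      then show ?thesis using d2(2) by blast
    qed
    \<comment> \<open>The increment between two parallel segments; \<open>0 *\<^sub>R v\<close>
      stays in place so that \<open>inS\<close>, \<open>der\<close> and \<open>app\<close> cover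
      both segments through \<open>r\<close>.\<close>
    define \<phi> where "\<phi> s = g (x + ((s * t) *\<^sub>R u + t *\<^sub>R v)) - g (x + ((s * t) *\<^sub>R u + 0 *\<^sub>R v))" for s
    have lin: "g' y (r *\<^sub>R w) = r * g' y w" if "y \<in> S" for y r w
      using linear_cmul[OF has_derivative_linear[OF g[OF that]], of r w] by simp
    have der: "((\<lambda>s. g (x + ((s * t) *\<^sub>R u + r *\<^sub>R v))) has_derivative
        (\<lambda>h. g' (x + ((s * t) *\<^sub>R u + r *\<^sub>R v)) ((h * t) *\<^sub>R u))) (at s within {0..1})"
      if "s \<in> {0..1}" "r \<in> {0, t}" for s r
    proof -
      have "((\<lambda>s. x + ((s * t) *\<^sub>R u + r *\<^sub>R v)) has_derivative (\<lambda>h. (h * t) *\<^sub>R u))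
          (at s within {0..1})"
        by (auto intro!: derivative_eq_intros)
      from has_derivative_compose[OF this g[OF inS[OF that]]] show ?thesis .
    qed
    have "\<exists>s\<in>{0..1}. \<phi> 1 - \<phi> 0 = g' (x + ((s * t) *\<^sub>R u + t *\<^sub>R v)) (((1 - 0) * t) *\<^sub>R u)
        - g' (x + ((s * t) *\<^sub>R u + 0 *\<^sub>R v)) (((1 - 0) * t) *\<^sub>R u)"
      unfolding \<phi>_def
      by (rule mvt_very_simple[where f' = "\<lambda>s h. g' (x + ((s * t) *\<^sub>R u + t *\<^sub>R v)) ((h * t) *\<^sub>R u)
        - g' (x + ((s * t) *\<^sub>R u + 0 *\<^sub>R v)) ((h * t) *\<^sub>R u)"])
        (auto intro!: has_derivative_diff der simp del: scaleR_zero_left)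
    then obtain s where s: "s \<in> {0..1}" and
      "\<phi> 1 - \<phi> 0 = g' (x + ((s * t) *\<^sub>R u + t *\<^sub>R v)) (t *\<^sub>R u) - g' (x + ((s * t) *\<^sub>R u + 0 *\<^sub>R v)) (t *\<^sub>R u)"
      by auto
    then have eq: "\<phi> 1 - \<phi> 0
        = t * (g' (x + ((s * t) *\<^sub>R u + t *\<^sub>R v)) u - g' (x + ((s * t) *\<^sub>R u + 0 *\<^sub>R v)) u)"
      using lin[OF inS[OF s, of t], of t u] lin[OF inS[OF s, of 0], of t u]
      by (simp add: right_diff_distrib)
    have app: "\<bar>g' (x + ((s * t) *\<^sub>R u + r *\<^sub>R v)) u - g' x u - (s * t * D u + r * D v)\<bar> \<le> e' * (t * M)"
      if "r \<in> {0, t}" for r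
    proof -
      have "D ((s * t) *\<^sub>R u + r *\<^sub>R v) = s * t * D u + r * D v"
        by (simp add: D.add D.scaleR)
      then have "\<bar>g' (x + ((s * t) *\<^sub>R u + r *\<^sub>R v)) u - g' x u - (s * t * D u + r * D v)\<bar>
          \<le> e' * norm ((s * t) *\<^sub>R u + r *\<^sub>R v)"
        using d1(2)[of "x + ((s * t) *\<^sub>R u + r *\<^sub>R v)"] small[OF s that] tM by simp
      also have "\<dots> \<le> e' * (t * M)" using small[OF s that] e' by (intro mult_left_mono) auto
      finally show ?thesis .
    qed
    \<comment> \<open>The terms \<open>s * t * D u\<close> of the two linearisations cancel, so the
      unknown intermediate point \<open>s\<close> disappears.\<close>
    have "\<bar>(g' (x + ((s * t) *\<^sub>R u + t *\<^sub>R v)) u - g' (x + ((s * t) *\<^sub>R u + 0 *\<^sub>R v)) u) - t * D v\<bar>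
        \<le> 2 * (e' * (t * M))"
      using app[of t] app[of 0] by simp
    also have "\<dots> = e * t" using M by (simp add: e'_def)
    finally have "t * \<bar>(g' (x + ((s * t) *\<^sub>R u + t *\<^sub>R v)) u - g' (x + ((s * t) *\<^sub>R u + 0 *\<^sub>R v)) u) - t * D v\<bar>
        \<le> t * (e * t)" using t by (intro mult_left_mono) auto
    moreover have "g (x + t *\<^sub>R u + t *\<^sub>R v) - g (x + t *\<^sub>R u) - g (x + t *\<^sub>R v) + g x - t\<^sup>2 * D v
      = t * ((g' (x + ((s * t) *\<^sub>R u + t *\<^sub>R v)) u - g' (x + ((s * t) *\<^sub>R u + 0 *\<^sub>R v)) u) - t * D v)"
      using eq by (simp add: \<phi>_def power2_eq_square algebra_simps)
    ultimately show ?thesis using t by (simp add: abs_mult power2_eq_square mult_ac)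
  qed
  ultimately show ?thesis by blast
qed

text \<open>Both sides are the limit of the second difference quotient
  \<open>(g (x + tu + tv) - g (x + tu) - g (x + tv) + g x) / t\<^sup>2\<close>, which is symmetric in \<open>u\<close>, \<open>v\<close>.\<close>

lemma second_derivative_symmetric:
  fixes g :: "'a::real_normed_vector \<Rightarrow> real"
  assumes S: "open S" "x \<in> S" and g: "\<And>y. y \<in> S \<Longrightarrow> (g has_derivative g' y) (at y)"
    and D: "\<And>u. ((\<lambda>y. g' y u) has_derivative D u) (at x)"
  shows "D u v = D v u"
proof (rule ccontr)
  assume "D u v \<noteq> D v u"
  define e where "e = \<bar>D u v - D v u\<bar> / 3"
  have "e > 0" using \<open>D u v \<noteq> D v u\<close> by (simp add: e_def)
  obtain d1 where d1: "d1 > 0" "\<And>t. 0 < t \<and> t < d1 \<Longrightarrow>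
    \<bar>g (x + t *\<^sub>R u + t *\<^sub>R v) - g (x + t *\<^sub>R u) - g (x + t *\<^sub>R v) + g x - t\<^sup>2 * D u v\<bar> \<le> e * t\<^sup>2"
    using second_difference[OF S g D \<open>e > 0\<close>] by metis
  obtain d2 where d2: "d2 > 0" "\<And>t. 0 < t \<and> t < d2 \<Longrightarrow>
    \<bar>g (x + t *\<^sub>R v + t *\<^sub>R u) - g (x + t *\<^sub>R v) - g (x + t *\<^sub>R u) + g x - t\<^sup>2 * D v u\<bar> \<le> e * t\<^sup>2"
    using second_difference[OF S g D \<open>e > 0\<close>] by metis
  define t where "t = min d1 d2 / 2"
  have t: "0 < t" "t < d1" "t < d2" using d1 d2 by (auto simp: t_def)
  have "x + t *\<^sub>R v + t *\<^sub>R u = x + t *\<^sub>R u + t *\<^sub>R v" by simp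
  then have "\<bar>t\<^sup>2 * D u v - t\<^sup>2 * D v u\<bar> \<le> 2 * (e * t\<^sup>2)"
    using d1(2)[of t] d2(2)[of t] t by (smt (verit))
  then have "t\<^sup>2 * \<bar>D u v - D v u\<bar> \<le> t\<^sup>2 * (2 * e)"
    unfolding right_diff_distrib[symmetric] abs_mult by (simp add: mult_ac)
  then have "\<bar>D u v - D v u\<bar> \<le> 2 * e" using t by simp
  with \<open>e > 0\<close> show False by (simp add: e_def)
qed

section \<open>Linear algebra at one point of an immersed surface\<close>

lemma matrix_inv_inj:
  fixes A :: "real^'n^'n"
  assumes "inj ((*v) A)"
  shows matrix_inv_left: "matrix_inv A ** A = mat 1" and matrix_inv_right: "A ** matrix_inv A = mat 1"
proof -
  have "\<exists>B. A ** B = mat 1 \<and> B ** A = mat 1"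
    using assms by (metis matrix_left_invertible_injective matrix_left_right_inverse)
  from someI_ex[OF this] show "matrix_inv A ** A = mat 1" "A ** matrix_inv A = mat 1"
    by (auto simp: matrix_inv_def)
qed

lemma matrix_mult_uminus:
  fixes A :: "real^'n^'m"
  shows "(- A) ** B = - (A ** B)" "(- A) *v x = - (A *v x)"
  by (simp_all add: vec_eq_iff matrix_matrix_mult_def matrix_vector_mult_def sum_negf)

lemma inj_matrix_iff: "inj ((*v) A) \<longleftrightarrow> (\<forall>x. A *v x = 0 \<longrightarrow> x = 0)" for A :: "real^'n^'m"
  by (metis matrix_left_invertible_injective matrix_left_invertible_ker)

lemma inner_matrix_transpose: "(A *v x) \<bullet> y = x \<bullet> (transpose A *v y)" for A :: "real^'n^'m"
  by (metis dot_lmul_matrix inner_commute transpose_matrix_vector transpose_transpose)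

lemma append_col_mult: "append_col M n *v c = M *v vector [c$1, c$2] + (c$3) *\<^sub>R n"
  by (simp add: append_col_def matrix_vector_mult_def vec_eq_iff sum_2 sum_3 mult.commute)

lemma rotate_component:
  "rotate (transpose (vector [f, g, n])) X $ i $ j = vector [f, g, n] $ i \<bullet> (X *v (vector [f, g, n] $ j))"
  by (simp add: rotate_def transpose_transpose matrix_matrix_mult_def matrix_vector_mult_def
      inner_vec_def transpose_def sum_3 algebra_simps)

text \<open>\<open>M\<close> and \<open>P\<close> play the roles of the gradients of the midsurface
  and of its unit normal \<open>n\<close>. The condition on \<open>P *v u\<close> reflects the
  constant length of the normal, and \<open>sym\<close> is the symmetry of the second fundamental
  form.\<close>

locale immersed_frame =
  fixes M P :: "real^2^3" and n :: "real^3"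
  assumes n: "norm n = 1" "\<And>u. (M *v u) \<bullet> n = 0" "\<And>u. (P *v u) \<bullet> n = 0"
    and M_inj: "\<And>u. M *v u = 0 \<Longrightarrow> u = 0"
    and sym: "\<And>u w. (P *v u) \<bullet> (M *v w) = (P *v w) \<bullet> (M *v u)"
begin

abbreviation "T \<equiv> append_col M n"
abbreviation "L \<equiv> matrix_inv (transpose M ** M) ** (- (transpose M ** P))"
abbreviation "B \<equiv> - (append_col P 0 ** matrix_inv T)"
abbreviation "C \<equiv> det T *\<^sub>R (transpose (matrix_inv T) ** J12 ** matrix_inv T)"

lemma nn: "n \<bullet> n = 1"
  using n(1) by (simp add: norm_eq_1)

lemma T_inj: "inj ((*v) T)"
  unfolding inj_matrix_iff
proof (intro allI impI)
  fix c :: "real^3" assume c: "T *v c = 0"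
  then have "(T *v c) \<bullet> n = 0" by simp
  then have "c $ 3 = 0" by (simp add: append_col_mult inner_add_left n nn)
  with c have "M *v vector [c$1, c$2] = 0" by (simp add: append_col_mult)
  from M_inj[OF this] have "c $ 1 = 0" "c $ 2 = 0" by (simp_all add: vec_eq_iff forall_2)
  with \<open>c $ 3 = 0\<close> show "c = 0" by (simp add: vec_eq_iff forall_3)
qed

lemma decompose: "\<exists>u s. a = M *v u + s *\<^sub>R n"
proof -
  have "a = T *v (matrix_inv T *v a)"
    by (simp add: matrix_vector_mul_assoc matrix_inv_right[OF T_inj])
  then show ?thesis unfolding append_col_mult by blast
qed

lemma B_mult: "B *v (M *v u + s *\<^sub>R n) = - (P *v u)"
proof -
  have "M *v u + s *\<^sub>R n = T *v (vector [u$1, u$2, s])"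
    by (simp add: append_col_mult) (simp add: matrix_vector_mult_def vec_eq_iff sum_2)
  moreover have "B ** T = - append_col P 0"
    by (simp add: matrix_mult_uminus matrix_mul_assoc[symmetric] matrix_inv_left[OF T_inj])
  ultimately have "B *v (M *v u + s *\<^sub>R n) = - append_col P 0 *v vector [u$1, u$2, s]"
    by (metis matrix_vector_mul_assoc)
  then show ?thesis
    by (simp add: append_col_def matrix_vector_mult_def vec_eq_iff sum_2 sum_3)
qed

lemma B_sym: "(B *v a) \<bullet> b = a \<bullet> (B *v b)"
proof -
  obtain u s u' s' where "a = M *v u + s *\<^sub>R n" "b = M *v u' + s' *\<^sub>R n"
    using decompose by meson
  then show ?thesis
    using sym[of u u'] n(3)[of u] n(3)[of u']
    by (simp only: B_mult) (simp add: inner_add_left inner_add_right inner_commute[of _ "P *v _"])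
qed

text \<open>The Weingarten equations: by the definition of \<open>L\<close>, the vector
  \<open>P *v u + M *v (L *v u)\<close> is orthogonal to all tangent vectors, and it is orthogonal
  to \<open>n\<close> as well.\<close>

lemma P_eq: "P *v u = - (M *v (L *v u))"
proof -
  have inj: "inj ((*v) (transpose M ** M))"
    unfolding inj_matrix_iff
  proof (intro allI impI)
    fix x assume "(transpose M ** M) *v x = 0"
    then have "(M *v x) \<bullet> (M *v x) = 0"
      by (simp add: inner_matrix_transpose matrix_vector_mul_assoc)
    then show "x = 0" using M_inj by simp
  qed
  have "(transpose M ** M) *v (L *v u) = (transpose M ** M ** matrix_inv (transpose M ** M)) ** (- (transpose M ** P)) *v u"
    by (simp add: matrix_vector_mul_assoc matrix_mul_assoc)
  also have "\<dots> = - (transpose M *v (P *v u))"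
    unfolding matrix_inv_right[OF inj]
    by (simp add: matrix_mult_uminus matrix_vector_mul_assoc)
  finally have "transpose M *v (P *v u + M *v (L *v u)) = 0"
    by (simp add: matrix_vector_right_distrib matrix_vector_mul_assoc matrix_mul_assoc)
  then have "(M *v w) \<bullet> (P *v u + M *v (L *v u)) = 0" for w
    by (simp add: inner_matrix_transpose)
  moreover have "n \<bullet> (P *v u + M *v (L *v u)) = 0"
    by (simp add: inner_add_right inner_commute[of n] n)
  ultimately have "a \<bullet> (P *v u + M *v (L *v u)) = 0" for a
    using decompose[of a] by (auto simp: inner_add_left)
  then have "P *v u + M *v (L *v u) = 0" by (metis inner_eq_zero_iff)
  then show ?thesis by (simp add: add_eq_0_iff)
qed

text \<open>\<open>L\<close> is the coordinate matrix of \<open>B\<close> on the tangent plane, so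
  eigenvectors can be carried between the two.\<close>

lemma B_M: "B *v (M *v u) = M *v (L *v u)"
  using B_mult[of u 0] P_eq[of u] by simp

lemma C_conj: "transpose T ** C ** T = det T *\<^sub>R J12"
proof -
  have "transpose T ** transpose (matrix_inv T) = mat 1"
    by (simp add: matrix_transpose_mul[symmetric] matrix_inv_left[OF T_inj])
  then show ?thesis
    by (simp add: matrix_mult_scaleR matrix_mul_assoc)
       (simp add: matrix_mul_assoc[symmetric] matrix_inv_left[OF T_inj])
qed

text \<open>One eigenvector suffices: its normalised image \<open>f\<close> and the normal
  \<open>n\<close> are orthogonal eigenvectors of the self-adjoint \<open>B\<close>, which forces
  the remaining frame vector \<open>g\<close> to be an eigenvector too. Its eigenvalue
  \<open>q\<close> may equal \<open>p\<close>, so \<open>det L\<close> and \<open>trace L\<close>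
  record the multiplicity that the set of eigenvalues loses.\<close>

lemma diagonalize:
  assumes v: "v \<noteq> 0" "L *v v = p *s v"
  shows "\<exists>R q. orthogonal_matrix R \<and> rotate R B = diag2 p q \<and> rotate R C = J12
    \<and> q \<in> eigenvalues L \<and> det L = p * q \<and> trace L = p + q"
proof -
  define u where "u = (1 / norm (M *v v)) *\<^sub>R v"
  define f where "f = M *v u"
  \<comment> \<open>This order of the cross product makes \<open>(f, g, n)\<close> positively
    oriented; the opposite choice would turn \<open>C\<close> into \<open>- J12\<close>.\<close>
  define g where "g = cross3 n f"
  define R where "R = transpose (vector [f, g, n] :: real^3^3)"
  define q where "q = g \<bullet> (B *v g)"
  have "M *v v \<noteq> 0" using v M_inj by blast
  have f_eq: "f = (1 / norm (M *v v)) *\<^sub>R (M *v v)"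
    by (simp add: f_def u_def scalar_mult_eq_scaleR[symmetric] vector_scalar_commute)
  have ff: "f \<bullet> f = 1" using \<open>M *v v \<noteq> 0\<close> by (simp add: f_eq dot_square_norm power2_eq_square)
  have fn: "f \<bullet> n = 0" by (simp add: f_def n)
  have gf: "g \<bullet> f = 0" "g \<bullet> n = 0" by (simp_all add: g_def dot_cross_self)
  have "(norm g)\<^sup>2 = 1"
    using norm_cross_dot[of n f] ff fn n(1)
    by (simp add: g_def inner_commute norm_eq_sqrt_inner)
  then have gg: "g \<bullet> g = 1" by (simp add: power2_norm_eq_inner)
  have "f \<bullet> cross3 g n = 1"
    using cross_triple[of g n f] gg by (simp add: g_def inner_commute)
  then have detR: "det R = 1"
    using dot_cross_det[of f g n] by (simp add: R_def det_transpose)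
  have RT: "transpose R = vector [f, g, n]" by (simp add: R_def transpose_transpose)
  have ortho: "orthogonal_matrix R"
    unfolding orthogonal_matrix RT R_def
    using ff gg nn fn gf
    by (simp add: vec_eq_iff forall_3 matrix_matrix_mult_def mat_def transpose_def inner_vec_def
        sum_3 mult.commute)
  have Lu: "L *v u = p *\<^sub>R u"
    using v(2) by (simp add: u_def vector_scalar_commute scalar_mult_eq_scaleR[symmetric])
  have Bf: "B *v f = p *\<^sub>R f"
    unfolding f_def B_M Lu by (simp add: scalar_mult_eq_scaleR[symmetric] vector_scalar_commute)
  have Bn: "B *v n = 0" using B_mult[of 0 1] by simp
  have fBg: "f \<bullet> (B *v g) = 0" using B_sym[of f g] Bf gf by (simp add: inner_commute)
  have nBg: "n \<bullet> (B *v g) = 0" using B_sym[of n g] Bn by simp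
  have rotB: "rotate R B = diag2 p q"
    unfolding R_def
    by (simp add: vec_eq_iff forall_3 rotate_component diag2_def Bf Bn fBg nBg ff gf fn
        inner_commute[of n f] q_def)
  obtain w s where ws: "g = M *v w + s *\<^sub>R n" using decompose by blast
  have "s = 0" using gf(2) by (simp add: ws inner_add_left n nn)
  then have gw: "g = M *v w" using ws by simp
  have exp: "a = (f \<bullet> a) *\<^sub>R f + (g \<bullet> a) *\<^sub>R g + (n \<bullet> a) *\<^sub>R n" for a
  proof -
    have "a = R *v (transpose R *v a)"
      using ortho by (simp add: matrix_vector_mul_assoc orthogonal_matrix_def del: transpose_matrix_vector)
    also have "\<dots> = (f \<bullet> a) *\<^sub>R f + (g \<bullet> a) *\<^sub>R g + (n \<bullet> a) *\<^sub>R n"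
      unfolding RT R_def by (simp add: vec_eq_iff matrix_vector_mult_def transpose_def inner_vec_def sum_3
          algebra_simps)
    finally show ?thesis .
  qed
  have Bg: "B *v g = q *\<^sub>R g" using exp[of "B *v g"] by (simp add: fBg nBg q_def)
  have "M *v (L *v w - q *\<^sub>R w) = 0"
    using Bg B_M[of w] unfolding gw
    by (simp add: matrix_vector_mult_diff_distrib scalar_mult_eq_scaleR[symmetric] vector_scalar_commute)
  then have Lw: "L *v w = q *\<^sub>R w" using M_inj by fastforce
  have "w \<noteq> 0" using gw gg by auto
  then have q_eig: "q \<in> eigenvalues L" using Lw by (auto simp: eigenvalues_def scalar_mult_eq_scaleR)
  \<comment> \<open>The columns are eigenvectors of \<open>L\<close> in surface coordinates, so
    \<open>V\<close> diagonalises \<open>L\<close> even though it is in general not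
    orthogonal.\<close>
  define V :: "real^2^2" where "V = transpose (vector [u, w])"
  define D :: "real^2^2" where "D = vector [vector [p, 0], vector [0, q]]"
  have V_mult: "V *v c = c$1 *\<^sub>R u + c$2 *\<^sub>R w" for c
    by (simp add: V_def matrix_vector_mult_def transpose_def vec_eq_iff sum_2 mult.commute)
  have Vinj: "inj ((*v) V)"
    unfolding inj_matrix_iff
  proof (intro allI impI)
    fix c assume "V *v c = 0"
    then have "M *v (V *v c) = 0" by simp
    then have 0: "c$1 *\<^sub>R f + c$2 *\<^sub>R g = 0"
      by (simp add: V_mult f_def gw matrix_vector_right_distrib scalar_mult_eq_scaleR[symmetric]
          vector_scalar_commute)
    have "f \<bullet> (c$1 *\<^sub>R f + c$2 *\<^sub>R g) = 0" "g \<bullet> (c$1 *\<^sub>R f + c$2 *\<^sub>R g) = 0" unfolding 0 by auto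
    then show "c = 0"
      using ff gg gf by (simp add: inner_add_right inner_commute[of f g] vec_eq_iff forall_2)
  qed
  have "L ** V = V ** D"
    unfolding matrix_eq
  proof
    fix c
    have "L ** V *v c = c$1 *\<^sub>R (L *v u) + c$2 *\<^sub>R (L *v w)"
      by (simp only: matrix_vector_mul_assoc[symmetric] V_mult matrix_vector_right_distrib
          scalar_mult_eq_scaleR[symmetric] vector_scalar_commute)
    also have "\<dots> = V *v (D *v c)"
      unfolding Lu Lw V_mult by (simp add: D_def matrix_vector_mult_def sum_2 mult.commute)
    also have "\<dots> = V ** D *v c" by (simp add: matrix_vector_mul_assoc)
    finally show "L ** V *v c = V ** D *v c" .
  qed
  then have L: "L = V ** D ** matrix_inv V"
    by (metis Vinj matrix_inv_right matrix_mul_assoc matrix_mul_rid)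
  have "det L = det V * det (matrix_inv V) * det D" unfolding L by (simp add: det_mul)
  also have "det V * det (matrix_inv V) = 1"
    unfolding det_mul[symmetric] matrix_inv_right[OF Vinj] by simp
  finally have detL: "det L = p * q" by (simp add: D_def det_2)
  have "trace L = trace D"
    unfolding L trace_mul_sym[of _ "matrix_inv V"] matrix_mul_assoc matrix_inv_left[OF Vinj] by simp
  then have trL: "trace L = p + q" by (simp add: D_def trace_def sum_2)
  \<comment> \<open>\<open>T\<close> expressed in the orthonormal frame: a tangential 2x2 block and
    a 1 for the normal.\<close>
  define A where "A = transpose R ** T"
  have T_A: "T = R ** A"
    using ortho by (simp add: A_def matrix_mul_assoc orthogonal_matrix_def)
  have A: "A$1$3 = 0" "A$2$3 = 0" "A$3$1 = 0" "A$3$2 = 0" "A$3$3 = 1"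
  proof -
    have "A $ i $ 3 = (vector [f, g, n] :: real^3^3) $ i \<bullet> n" for i
      by (simp add: A_def RT matrix_matrix_mult_def append_col_def inner_vec_def)
    then show "A$1$3 = 0" "A$2$3 = 0" "A$3$3 = 1" using fn gf nn by auto
    have "A $ 3 $ 1 = (M *v axis 1 1) \<bullet> n" "A $ 3 $ 2 = (M *v axis 2 1) \<bullet> n"
      by (simp_all add: A_def RT matrix_matrix_mult_def append_col_def inner_vec_def
          matrix_vector_mult_basis column_def mult.commute)
    then show "A$3$1 = 0" "A$3$2 = 0" using n(2) by simp_all
  qed
  have detT: "det T = det A" by (simp add: T_A det_mul detR)
  have "transpose A ** rotate R C ** A = transpose T ** C ** T"
    by (simp add: rotate_def T_A[symmetric] matrix_mul_assoc)
       (simp add: T_A matrix_transpose_mul matrix_mul_assoc)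
  also have "\<dots> = det T *\<^sub>R J12" by (rule C_conj)
  \<comment> \<open>For a 2x2 block \<open>a\<close>, the congruence of the unit skew matrix by
    \<open>a\<close> multiplies it by \<open>det a\<close>. This explains the determinant factor in
    \<open>C\<close>.\<close>
  also have "\<dots> = transpose A ** J12 ** A"
    unfolding detT using A by (simp add: vec_eq_iff forall_3 J12_def matrix_matrix_mult_def transpose_def sum_3 det_3)
  finally have eq: "transpose A ** rotate R C ** A = transpose A ** J12 ** A" .
  have "inj ((*v) A)"
    using T_inj T_A unfolding inj_matrix_iff
    by (metis matrix_vector_mul_assoc matrix_vector_mult_0_right)
  then have inv: "A ** matrix_inv A = mat 1" by (rule matrix_inv_right)
  then have inv': "transpose (matrix_inv A) ** transpose A = mat 1"
    by (metis matrix_transpose_mul transpose_mat)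
  have "rotate R C = transpose (matrix_inv A) ** (transpose A ** rotate R C ** A) ** matrix_inv A"
    by (simp add: matrix_mul_assoc inv') (simp add: matrix_mul_assoc[symmetric] inv)
  also have "\<dots> = J12"
    unfolding eq by (simp add: matrix_mul_assoc inv') (simp add: matrix_mul_assoc[symmetric] inv)
  finally have "rotate R C = J12" .
  with ortho rotB q_eig detL trL show ?thesis by blast
qed

end

text \<open>On the slice of height zero \<open>Theta y0\<close> is \<open>y0\<close> whatever
  \<open>normal_field\<close> is, so there is no circularity with the normal being well defined.
  Composing \<open>y0\<close> with the differentiable inverse gives the linear inclusion
  \<open>emb\<close>, and the chain rule makes \<open>y'\<close> injective.\<close>

lemma immersion_of_diffeo:
  assumes "open \<omega>" "x \<in> \<omega>" and h: "h > 0"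
    and diffeo: "C1_diffeo_onto_image (Theta y0) (shell_body \<omega> h)"
    and y: "(y0 has_derivative y') (at x)" and v: "y' v = 0"
  shows "v = 0"
proof -
  define emb :: "real^2 \<Rightarrow> real^3" where "emb z = vector [z$1, z$2, 0]" for z
  let ?S = "shell_body \<omega> h" and ?g = "inv_into (shell_body \<omega> h) (Theta y0)"
  have base: "base_point (emb z) = z" for z
    by (simp add: emb_def base_point_def vec_eq_iff forall_2)
  have emb_in: "emb z \<in> ?S" if "z \<in> \<omega>" for z
    using that h base[of z] by (simp add: shell_body_def) (simp add: emb_def)
  have Theta_emb: "Theta y0 (emb z) = y0 z" for z
    by (simp add: Theta_def base) (simp add: emb_def)
  have inj: "inj_on (Theta y0) ?S" using diffeo by (simp add: C1_diffeo_onto_image_def)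
  have g_y0: "?g (y0 z) = emb z" if "z \<in> \<omega>" for z
    using inv_into_f_f[OF inj emb_in[OF that]] by (simp add: Theta_emb)
  have "y0 x \<in> Theta y0 ` ?S" using emb_in[OF \<open>x \<in> \<omega>\<close>] Theta_emb by (metis image_eqI)
  then obtain G where G: "(?g has_derivative blinfun_apply G) (at (y0 x))"
    using diffeo unfolding C1_diffeo_onto_image_def C1_on_def by blast
  have "((\<lambda>z. ?g (y0 z)) has_derivative (\<lambda>v. G (y' v))) (at x)"
    by (rule has_derivative_compose[OF y G])
  then have 1: "(emb has_derivative (\<lambda>v. G (y' v))) (at x)"
    by (rule has_derivative_transform_within_open[OF _ \<open>open \<omega>\<close> \<open>x \<in> \<omega>\<close>]) (rule g_y0)
  have "linear emb" by (rule linearI) (simp_all add: emb_def vec_eq_iff forall_3)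
  then have 2: "(emb has_derivative emb) (at x)" by (rule linear_imp_has_derivative)
  have "emb v = G (y' v)" using has_derivative_unique[OF 1 2] by (metis)
  then have "emb v = 0" using v by simp
  then show ?thesis by (simp add: emb_def vec_eq_iff forall_2 forall_3)
qed

section \<open>The frame conditions for the midsurface\<close>

lemma jacobian_eq: "(f has_derivative f') (at x) \<Longrightarrow> jacobian f (at x) = matrix f'"
  for f :: "real^'n \<Rightarrow> real^'m"
  by (metis frechet_derivative_at jacobian_def)

lemma jacobian_apply:
  fixes f :: "real^'n \<Rightarrow> real^'m"
  assumes "(f has_derivative f') (at x)"
  shows "jacobian f (at x) *v u = f' u"
proof -
  have "(f has_derivative (\<lambda>u. jacobian f (at x) *v u)) (at x)"
    using assms jacobian_works differentiableI by blast
  from has_derivative_unique[OF this assms] show ?thesis by metis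
qed

lemma has_derivative_blinfun_apply:
  assumes "(F has_derivative F') (at x)"
  shows "((\<lambda>y. blinfun_apply (F y) u) has_derivative (\<lambda>v. blinfun_apply (F' v) u)) (at x)"
  by (rule bounded_linear.has_derivative[OF blinfun.bounded_linear_left assms])

text \<open>Differentiating the identities "normal dot normal is 1" and "normal dot tangent is 0"
  yields the conditions on the derivative of the normal; the second identity also expresses it
  through the second derivative of \<open>y0\<close>, whose symmetry gives
  \<open>sym\<close>.\<close>

lemma midsurface_frame:
  assumes \<omega>: "open \<omega>" and x: "x \<in> \<omega>" and h: "h > 0"
    and C2: "C2_on y0 \<omega>"
    and diffeo: "C1_diffeo_onto_image (Theta y0) (shell_body \<omega> h)"
  shows "immersed_frame (jacobian y0 (at x)) (jacobian (normal_field y0) (at x)) (normal_field y0 x)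
    \<and> grad_Theta0 y0 x = append_col (jacobian y0 (at x)) (normal_field y0 x)"
proof -
  obtain f' where f': "\<And>y. y \<in> \<omega> \<Longrightarrow> (y0 has_derivative blinfun_apply (f' y)) (at y)"
    and "C1_on f' \<omega>" using C2 unfolding C2_on_def by blast
  then obtain f'' where f'': "\<And>y. y \<in> \<omega> \<Longrightarrow> (f' has_derivative blinfun_apply (f'' y)) (at y)"
    unfolding C1_on_def by blast
  define m where "m i y = blinfun_apply (f' y) (axis i 1)" for i y
  define N where "N y = cross3 (m 1 y) (m 2 y)" for y
  let ?n = "normal_field y0"
  have expand: "blinfun_apply (f' y) u = u$1 *\<^sub>R m 1 y + u$2 *\<^sub>R m 2 y" for y u
  proof -
    have "u = u$1 *\<^sub>R axis 1 1 + u$2 *\<^sub>R axis 2 1"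
      by (simp add: vec_eq_iff forall_2 axis_def)
    then show ?thesis unfolding m_def by (metis blinfun.add_right blinfun.scaleR_right)
  qed
  have immersion: "v = 0" if "y \<in> \<omega>" "blinfun_apply (f' y) v = 0" for y v
    using immersion_of_diffeo[OF \<omega> that(1) h diffeo f'[OF that(1)] that(2)] .
  have "N y \<noteq> 0" if "y \<in> \<omega>" for y
  proof
    assume "N y = 0"
    then have "m 1 y = 0 \<or> m 2 y = 0 \<or> (\<exists>c. m 2 y = c *\<^sub>R m 1 y)"
      unfolding N_def cross_eq_0 collinear_lemma .
    then consider "m 1 y = 0" | "m 2 y = 0" | c where "m 2 y = c *\<^sub>R m 1 y" by blast
    then show False
    proof cases
      case 1
      then show False using immersion[OF that, of "axis 1 1"] by (simp add: m_def)
    next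
      case 2
      then show False using immersion[OF that, of "axis 2 1"] by (simp add: m_def)
    next
      case 3
      then have "blinfun_apply (f' y) (vector [- c, 1]) = 0" by (simp add: expand)
      from immersion[OF that this] show False by (simp add: vec_eq_iff forall_2)
    qed
  qed
  note N0 = this
  have col: "column i (jacobian y0 (at y)) = m i y" if "y \<in> \<omega>" for i y
    by (simp add: jacobian_eq[OF f'[OF that]] column_def matrix_def m_def vec_eq_iff)
  have n_eq: "?n y = (1 / norm (N y)) *\<^sub>R N y" if "y \<in> \<omega>" for y
    by (simp add: normal_field_def Let_def col[OF that] N_def divide_inverse)
  have n_norm: "?n y \<bullet> ?n y = 1" if "y \<in> \<omega>" for y
    using N0[OF that] by (simp add: n_eq[OF that] dot_square_norm power2_eq_square)
  have n_ortho: "?n y \<bullet> blinfun_apply (f' y) u = 0" if "y \<in> \<omega>" for y u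
    by (simp add: n_eq[OF that] expand N_def inner_add_right dot_cross_self)
  have dm: "(m i has_derivative (\<lambda>v. blinfun_apply (blinfun_apply (f'' x) v) (axis i 1))) (at x)" for i
    unfolding m_def[abs_def] by (rule has_derivative_blinfun_apply[OF f''[OF x]])
  have "bounded_bilinear cross3"
    using bilinear_cross by (simp add: bilinear_conv_bounded_bilinear)
  from bounded_bilinear.FDERIV[OF this dm[of 1] dm[of 2]] have "N differentiable at x"
    unfolding N_def[abs_def] by (rule differentiableI)
  then have "(\<lambda>y. (1 / norm (N y)) *\<^sub>R N y) differentiable at x"
    using N0[OF x] by (intro differentiable_scaleR differentiable_divide differentiable_const
        differentiable_compose[of norm N]) auto
  then obtain Dn where "((\<lambda>y. (1 / norm (N y)) *\<^sub>R N y) has_derivative Dn) (at x)"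
    unfolding differentiable_def by blast
  then have Dn: "(?n has_derivative Dn) (at x)"
    by (rule has_derivative_transform_within_open[OF _ \<omega> x]) (simp add: n_eq)
  have J: "jacobian y0 (at x) *v u = blinfun_apply (f' x) u" for u
    by (rule jacobian_apply[OF f'[OF x]])
  have Jn: "jacobian ?n (at x) *v u = Dn u" for u
    by (rule jacobian_apply[OF Dn])
  have const_deriv: "F' v = 0"
    if "(F has_derivative F') (at x)" "\<And>y. y \<in> \<omega> \<Longrightarrow> F y = (c::real)" for F F' v c
  proof -
    have "((\<lambda>y. c) has_derivative F') (at x)"
      by (rule has_derivative_transform_within_open[OF that(1) \<omega> x]) (rule that(2))
    then have "F' = (\<lambda>v. 0)" by (rule has_derivative_unique) (rule has_derivative_const)
    then show ?thesis by simp
  qed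
  have Dn_n: "Dn v \<bullet> ?n x = 0" for v
    using const_deriv[OF has_derivative_inner[OF Dn Dn] n_norm, of v] by (simp add: inner_commute)
  have Dn_f: "Dn v \<bullet> blinfun_apply (f' x) u = - (?n x \<bullet> blinfun_apply (blinfun_apply (f'' x) v) u)" for u v
    using const_deriv[OF has_derivative_inner[OF Dn has_derivative_blinfun_apply[OF f''[OF x]]] n_ortho, of v u]
    by simp
  \<comment> \<open>The normal is frozen at \<open>x\<close>, which reduces the symmetry to a scalar
    function.\<close>
  have second: "?n x \<bullet> blinfun_apply (blinfun_apply (f'' x) v) u
      = ?n x \<bullet> blinfun_apply (blinfun_apply (f'' x) u) v" for u v
    by (rule second_derivative_symmetric[OF \<omega> x, where g = "\<lambda>y. ?n x \<bullet> y0 y"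
          and g' = "\<lambda>y w. ?n x \<bullet> blinfun_apply (f' y) w"])
      (auto intro!: has_derivative_inner_right f' has_derivative_blinfun_apply f'' x)
  have "norm (?n x) = 1" using n_norm[OF x] by (simp add: norm_eq_1)
  then have "immersed_frame (jacobian y0 (at x)) (jacobian ?n (at x)) (?n x)"
    using n_ortho[OF x] Dn_n immersion[OF x] second
    by unfold_locales (auto simp: J Jn Dn_f inner_commute[of _ "?n x"])
  moreover have "grad_Theta0 y0 x = append_col (jacobian y0 (at x)) (?n x)"
    using f'[OF x] Dn by (intro grad_Theta0_eq differentiableI)
  ultimately show ?thesis ..
qed

lemma midsurface_diagonalize:
  assumes "open \<omega>" "x \<in> \<omega>" "h > 0" "C2_on y0 \<omega>"
    and "C1_diffeo_onto_image (Theta y0) (shell_body \<omega> h)"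
    and p: "p \<in> eigenvalues (Weingarten y0 x)"
  shows "\<exists>R q. orthogonal_matrix R \<and> rotate R (B_mat y0 x) = diag2 p q \<and> rotate R (C_mat y0 x) = J12
    \<and> q \<in> eigenvalues (Weingarten y0 x) \<and> gauss_curv y0 x = p * q \<and> mean_curv y0 x = (p + q) / 2"
proof -
  let ?M = "jacobian y0 (at x)" and ?P = "jacobian (normal_field y0) (at x)" and ?n = "normal_field y0 x"
  have frame: "immersed_frame ?M ?P ?n" and G: "grad_Theta0 y0 x = append_col ?M ?n"
    using midsurface_frame[OF assms(1-5)] by auto
  obtain v where "v \<noteq> 0" "Weingarten y0 x *v v = p *s v"
    using p by (auto simp: eigenvalues_def)
  from immersed_frame.diagonalize[OF frame this[unfolded Weingarten_def fund_form1_def fund_form2_def]]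
  show ?thesis
    unfolding B_mat_def C_mat_def gauss_curv_def mean_curv_def Weingarten_def fund_form1_def
      fund_form2_def G J12_def by auto
qed


section \<open>Uniform convexity\<close>

text \<open>The constant is about 13.95. The rounded value 16 is what
  \<open>coercive_small_thickness\<close> tolerates, and positivity of the constant yields
  \<open>c2 / C1 > 0\<close>.\<close>

lemma thickness_constant: "(47/4)\<^sup>2 * (5 - 2 * sqrt 6) \<le> 16" "0 < (47/4)\<^sup>2 * (5 - 2 * sqrt 6)"
proof -
  have "2449/1000 \<le> sqrt 6" by (rule real_le_rsqrt) (simp add: power2_eq_square)
  then show "(47/4)\<^sup>2 * (5 - 2 * sqrt 6) \<le> 16" by (simp add: power2_eq_square)
  have "sqrt 6 < 249/100" by (rule real_less_lsqrt) (simp_all add: power2_eq_square)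
  then show "0 < (47/4)\<^sup>2 * (5 - 2 * sqrt 6)" by (simp add: power2_eq_square)
qed

text \<open>The second entry of the maximum is the larger root of
  \<open>4 * a\<^sup>2 - 4 * a = 3 * \<rho>\<^sup>2\<close>. Hence
  \<open>9 * \<rho>\<^sup>2 + 6 < 12 * a\<^sup>2 - 12 * a + 6\<close>, which is below
  \<open>12 * a\<^sup>2\<close> as soon as \<open>a > 1/2\<close>.\<close>

lemma curvature_constant:
  assumes a: "a > max (1 + sqrt 2 / 2) ((1 + sqrt (1 + 3 * \<rho>\<^sup>2)) / 2)"
  shows "(1/a)\<^sup>2 * (1 + (2 + \<rho>)\<^sup>2) < 12"
proof -
  have "14/10 \<le> sqrt 2" by (rule real_le_rsqrt) (simp add: power2_eq_square)
  with a have a17: "a > 17/10" by simp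
  have "sqrt (1 + 3 * \<rho>\<^sup>2) < 2 * a - 1" using a by simp
  then have "(sqrt (1 + 3 * \<rho>\<^sup>2))\<^sup>2 < (2 * a - 1)\<^sup>2" by (intro power_strict_mono) auto
  moreover have "(sqrt (1 + 3 * \<rho>\<^sup>2))\<^sup>2 = 1 + 3 * \<rho>\<^sup>2" by simp
  moreover have "(2 * a - 1)\<^sup>2 = 4 * a\<^sup>2 - 4 * a + 1" by (simp add: power2_eq_square algebra_simps)
  moreover have "1 + (2 + \<rho>)\<^sup>2 = 9 * \<rho>\<^sup>2 + 6 - (2 * \<rho> - 1)\<^sup>2 - 4 * \<rho>\<^sup>2"
    by (simp add: power2_eq_square algebra_simps)
  moreover have "0 \<le> (2 * \<rho> - 1)\<^sup>2" "0 \<le> \<rho>\<^sup>2" by auto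
  ultimately have "1 + (2 + \<rho>)\<^sup>2 < 12 * a\<^sup>2" using a17 by linarith
  then show ?thesis using a17 by (simp add: power_divide field_simps)
qed

theorem corollary4p2:
  fixes \<omega> :: "(real^2) set" and y0 :: "real^2 \<Rightarrow> real^3"
    and h \<mu> lam \<mu>c Lc b1 b2 b3 c1 C1 c2 :: real
    and \<kappa>1 \<kappa>2 :: "real^2 \<Rightarrow> real"
  assumes "bounded_lipschitz_domain \<omega>"
    and "C2_on y0 \<omega>"
    and "h > 0"
    and "C1_diffeo_onto_image (Theta y0) (shell_body \<omega> h)"
    and "\<And>x. x \<in> \<omega> \<Longrightarrow> {\<kappa>1 x, \<kappa>2 x} = eigenvalues (Weingarten y0 x)"
    and "Lc > 0" and "\<mu> > 0" and "\<mu>c > 0" and "2 * lam + \<mu> > 0"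
    and "b1 > 0" and "b2 > 0" and "b3 > 0"
    and "smallest_eigenvalue (W_curv \<mu> Lc b1 b2 b3) c2"
    and "smallest_eigenvalue (W_shell \<mu> lam \<mu>c) c1"
    and "largest_eigenvalue (W_shell \<mu> lam \<mu>c) C1" and "C1 > 0"
    and "((\<forall>x\<in>\<omega>. h * \<bar>\<kappa>1 x\<bar> < 1/2 \<and> h * \<bar>\<kappa>2 x\<bar> < 1/2)
            \<and> h\<^sup>2 < (47/4)\<^sup>2 * (5 - 2 * sqrt 6) * (c2 / C1))
         \<or> (\<exists>a. a > max (1 + sqrt 2 / 2) ((1 + sqrt (1 + 3 * (C1 / c1))) / 2)
            \<and> (\<forall>x\<in>\<omega>. h * \<bar>\<kappa>1 x\<bar> < 1/a \<and> h * \<bar>\<kappa>2 x\<bar> < 1/a))"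
  shows "\<exists>a1 > 0. \<forall>x\<in>\<omega>. \<forall>E K H1 H2.
    D2 (W_h3 h \<mu> lam \<mu>c Lc b1 b2 b3 y0 x) (E, K) (H1, H2) (H1, H2)
      \<ge> a1 * ((norm H1)\<^sup>2 + (norm H2)\<^sup>2)"
proof -
  interpret shell_coeffs \<mu> lam \<mu>c
    using assms(7,8,9) by unfold_locales
  let ?V = "W_curv \<mu> Lc b1 b2 b3"
  have h: "h > 0" and C1_pos: "C1 > 0" by fact+
  have \<omega>_open: "open \<omega>" using assms(1) by (simp add: bounded_lipschitz_domain_def)

  have c1_le: "c1 \<le> \<mu>" "c1 \<le> \<mu>c" "c1 \<le> bulk"
    and C1_ge: "\<mu> \<le> C1" "\<mu>c \<le> C1" "bulk \<le> C1"
    using assms(14,15) weights_shell_eigenvalues[of \<mu> \<mu>c lam]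
    by (auto simp: smallest_eigenvalue_def largest_eigenvalue_def bulk_def)
  have c1_W: "c1 * (norm S)\<^sup>2 \<le> W S" for S
    unfolding W_split by (rule weighted_lower[OF c1_le])
  have C1_W: "W S \<le> C1 * (norm S)\<^sup>2" for S
    unfolding W_split by (rule weighted_upper[OF C1_ge])
  have "min \<mu> (min \<mu>c bulk) \<le> c1"
    using assms(14) W_lower
    by (intro form_eigenvalue_bound[of c1 W])
      (auto simp: smallest_eigenvalue_def polar_form_W_shell W_shell_bilin_same)
  with min_weight_pos have c1_pos: "c1 > 0" by linarith

  \<comment> \<open>The smallest weight of the curvature form, a visibly positive lower bound that
    serves under both conditions.\<close>
  define v where "v = min (\<mu> * Lc\<^sup>2 * b1) (min (\<mu> * Lc\<^sup>2 * b2) (3 * (\<mu> * Lc\<^sup>2 * b3)))"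
  have v_pos: "v > 0" using assms(6,7,10,11,12) by (simp add: v_def)
  have v_V: "v * (norm S)\<^sup>2 \<le> ?V S" for S
    unfolding W_curv_split by (rule weighted_lower) (auto simp: v_def)
  have V_nonneg: "?V S \<ge> 0" for S
    using v_V[of S] v_pos by (meson order_trans zero_le_mult_iff zero_le_power2 less_imp_le)
  have c2_V: "c2 * (norm S)\<^sup>2 \<le> ?V S" for S
    unfolding W_curv_split using assms(13) weights_curv_eigenvalues[of \<mu> Lc b1 b2 b3]
    by (intro weighted_lower) (auto simp: smallest_eigenvalue_def)

  \<comment> \<open>The second curvature ranges over both values because the eigenvalue set carries
    no multiplicity: at an umbilic point it is \<open>\<kappa>1 x\<close> again. The constant
    \<open>d\<close> is chosen before the point.\<close>
  have "\<exists>d>0. \<forall>x\<in>\<omega>. \<forall>q\<in>{\<kappa>1 x, \<kappa>2 x}. \<forall>E K.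
      shell_energy \<mu> lam \<mu>c (Lc / h) b1 b2 b3 1 (diag2 (h * \<kappa>1 x) (h * q)) J12 (h * \<kappa>1 x * (h * q))
        ((h * \<kappa>1 x + h * q) / 2) E K
      \<ge> d * (W E + W_curv \<mu> (Lc / h) b1 b2 b3 K)"
    using assms(17)
  proof
    assume A: "(\<forall>x\<in>\<omega>. h * \<bar>\<kappa>1 x\<bar> < 1/2 \<and> h * \<bar>\<kappa>2 x\<bar> < 1/2)
      \<and> h\<^sup>2 < (47/4)\<^sup>2 * (5 - 2 * sqrt 6) * (c2 / C1)"
    have "h\<^sup>2 > 0" using h by simp
    with A have "0 < (47/4)\<^sup>2 * (5 - 2 * sqrt 6) * (c2 / C1)" by linarith
    with thickness_constant(2) have "0 < c2 / C1" using zero_less_mult_pos by blast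
    then have "(47/4)\<^sup>2 * (5 - 2 * sqrt 6) * (c2 / C1) \<le> 16 * (c2 / C1)"
      by (intro mult_right_mono thickness_constant) auto
    with A have "h\<^sup>2 \<le> 16 * (c2 / C1)" by linarith
    then have hC1: "C1 * h\<^sup>2 \<le> 16 * c2" using C1_pos by (simp add: field_simps)
    have curv: "C1 * (norm S)\<^sup>2 \<le> 16 * W_curv \<mu> (Lc / h) b1 b2 b3 S" for S
    proof -
      have "C1 * h\<^sup>2 * (norm S)\<^sup>2 \<le> 16 * c2 * (norm S)\<^sup>2" using hC1 by (intro mult_right_mono) auto
      also have "\<dots> \<le> 16 * ?V S" using c2_V[of S] by simp
      finally show ?thesis using h by (simp add: W_curv_length_scale field_simps)
    qed
    have bound: "\<bar>h * q\<bar> \<le> 1/2" if "x \<in> \<omega>" "q \<in> {\<kappa>1 x, \<kappa>2 x}" for x q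
      using A that h by (auto simp: abs_mult less_imp_le)
    show ?thesis
      by (intro exI[of _ "1/5"] conjI ballI allI bound
          coercive_small_thickness[OF _ _ C1_ge(1,2) C1_W curv]) auto
  next
    assume "\<exists>a. a > max (1 + sqrt 2 / 2) ((1 + sqrt (1 + 3 * (C1 / c1))) / 2)
      \<and> (\<forall>x\<in>\<omega>. h * \<bar>\<kappa>1 x\<bar> < 1/a \<and> h * \<bar>\<kappa>2 x\<bar> < 1/a)"
    then obtain a where a: "a > max (1 + sqrt 2 / 2) ((1 + sqrt (1 + 3 * (C1 / c1))) / 2)"
      and A: "\<And>x. x \<in> \<omega> \<Longrightarrow> h * \<bar>\<kappa>1 x\<bar> < 1/a \<and> h * \<bar>\<kappa>2 x\<bar> < 1/a" by blast
    define \<rho> where "\<rho> = sqrt (C1 / c1)"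
    define r where "r = 1 / a"
    have \<rho>: "\<rho> > 0" "\<rho>\<^sup>2 = C1 / c1" using c1_pos C1_pos by (simp_all add: \<rho>_def)
    have "a > 1" using a by (smt (verit) max_less_iff_conj real_sqrt_ge_zero divide_nonneg_pos)
    then have r: "r > 0" by (simp add: r_def)
    have small: "r\<^sup>2 * (1 + (2 + \<rho>)\<^sup>2) < 12"
      unfolding r_def using a by (intro curvature_constant) (simp add: \<rho>)
    define d where "d = 1 - r\<^sup>2 * (1 + (2 + \<rho>)\<^sup>2) / 12"
    have d: "d > 0" using small by (simp add: d_def)
    have "r\<^sup>2 * 1 \<le> r\<^sup>2 * (1 + (2 + \<rho>)\<^sup>2)" by (intro mult_left_mono) auto
    then have d_le: "d \<le> 1 - r\<^sup>2 / 12" by (simp add: d_def)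
    have upper: "W S \<le> \<rho>\<^sup>2 * c1 * (norm S)\<^sup>2" for S using C1_W[of S] c1_pos by (simp add: \<rho>)
    have V'_nonneg: "W_curv \<mu> (Lc / h) b1 b2 b3 S \<ge> 0" for S
      using V_nonneg by (simp add: W_curv_length_scale)
    have bound: "\<bar>h * q\<bar> \<le> r" if "x \<in> \<omega>" "q \<in> {\<kappa>1 x, \<kappa>2 x}" for x q
      using A[OF that(1)] that(2) h by (auto simp: abs_mult r_def)
    have weaken: "d * (W E + W_curv \<mu> (Lc / h) b1 b2 b3 K)
        \<le> d * W E + (1 - r\<^sup>2 / 12) * W_curv \<mu> (Lc / h) b1 b2 b3 K" for E K
      using mult_right_mono[OF d_le V'_nonneg[of K]] by (simp add: distrib_left)
    show ?thesis
      by (intro exI[of _ d] conjI ballI allI d bound order_trans[OF weaken]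
          coercive_small_curvature[OF _ _ r c1_W upper \<rho>(1) V'_nonneg, folded d_def]) auto
  qed
  then obtain d where d: "d > 0" and coercive: "\<And>x q E K. x \<in> \<omega> \<Longrightarrow> q \<in> {\<kappa>1 x, \<kappa>2 x} \<Longrightarrow>
      shell_energy \<mu> lam \<mu>c (Lc / h) b1 b2 b3 1 (diag2 (h * \<kappa>1 x) (h * q)) J12 (h * \<kappa>1 x * (h * q))
        ((h * \<kappa>1 x + h * q) / 2) E K
      \<ge> d * (W E + W_curv \<mu> (Lc / h) b1 b2 b3 K)" by blast

  \<comment> \<open>The 2 comes from differentiating a quadratic form twice, \<open>h\<close> from
    the scaling, and \<open>min c1 v\<close> from comparing both energies with norms.\<close>
  define a1 where "a1 = 2 * (h * (d * min c1 v))"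
  have "D2 (W_h3 h \<mu> lam \<mu>c Lc b1 b2 b3 y0 x) (E, K) (H1, H2) (H1, H2)
      \<ge> a1 * ((norm H1)\<^sup>2 + (norm H2)\<^sup>2)" if x: "x \<in> \<omega>" for x E K H1 H2
  proof -
    have eig: "{\<kappa>1 x, \<kappa>2 x} = eigenvalues (Weingarten y0 x)" using assms(5) x .
    then have "\<kappa>1 x \<in> eigenvalues (Weingarten y0 x)" by blast
    from midsurface_diagonalize[OF \<omega>_open x h assms(2,4) this] eig
    obtain R q where R: "orthogonal_matrix R" and B: "rotate R (B_mat y0 x) = diag2 (\<kappa>1 x) q"
      and C: "rotate R (C_mat y0 x) = J12" and q: "q \<in> {\<kappa>1 x, \<kappa>2 x}"
      and G: "gauss_curv y0 x = \<kappa>1 x * q" and H: "mean_curv y0 x = (\<kappa>1 x + q) / 2"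
      by metis
    let ?E = "rotate R H1" and ?K = "rotate R H2"
    have scale: "h *\<^sub>R diag2 (\<kappa>1 x) q = diag2 (h * \<kappa>1 x) (h * q)"
      "h\<^sup>2 * (\<kappa>1 x * q) = h * \<kappa>1 x * (h * q)" "h * ((\<kappa>1 x + q) / 2) = (h * \<kappa>1 x + h * q) / 2"
      by (simp_all add: diag2_def vec_eq_iff forall_3 power2_eq_square distrib_left)
    have "W_h3 h \<mu> lam \<mu>c Lc b1 b2 b3 y0 x (H1, H2) = shell_energy \<mu> lam \<mu>c Lc b1 b2 b3 h
        (diag2 (\<kappa>1 x) q) J12 (\<kappa>1 x * q) ((\<kappa>1 x + q) / 2) ?E ?K"
      unfolding W_h3_eq prod.case by (subst rotate_shell_energy[OF R]) (simp only: B C G H)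
    also have "\<dots> = h * shell_energy \<mu> lam \<mu>c (Lc / h) b1 b2 b3 1 (diag2 (h * \<kappa>1 x) (h * q)) J12
        (h * \<kappa>1 x * (h * q)) ((h * \<kappa>1 x + h * q) / 2) ?E (h *\<^sub>R ?K)"
      by (subst shell_energy_scale[OF h]) (simp only: scale)
    also have "\<dots> \<ge> h * (d * (W ?E + W_curv \<mu> (Lc / h) b1 b2 b3 (h *\<^sub>R ?K)))"
      using h by (intro mult_left_mono coercive x q) auto
    also have "W_curv \<mu> (Lc / h) b1 b2 b3 (h *\<^sub>R ?K) = ?V ?K"
      using h by (simp add: W_curv_length_scale W_curv_scale)
    finally have lower: "h * (d * (W ?E + ?V ?K)) \<le> W_h3 h \<mu> lam \<mu>c Lc b1 b2 b3 y0 x (H1, H2)" .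
    have "min c1 v * (norm H1)\<^sup>2 \<le> c1 * (norm ?E)\<^sup>2" "min c1 v * (norm H2)\<^sup>2 \<le> v * (norm ?K)\<^sup>2"
      by (simp_all add: rotate_norm[OF R] mult_right_mono)
    then have "min c1 v * ((norm H1)\<^sup>2 + (norm H2)\<^sup>2) \<le> W ?E + ?V ?K"
      using c1_W[of ?E] v_V[of ?K] unfolding distrib_left by linarith
    then have "h * (d * (min c1 v * ((norm H1)\<^sup>2 + (norm H2)\<^sup>2))) \<le> h * (d * (W ?E + ?V ?K))"
      using h d by (intro mult_left_mono) auto
    with lower have "a1 * ((norm H1)\<^sup>2 + (norm H2)\<^sup>2) \<le> 2 * W_h3 h \<mu> lam \<mu>c Lc b1 b2 b3 y0 x (H1, H2)"
      unfolding a1_def by (simp add: mult.assoc)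
    also have "\<dots> = D2 (W_h3 h \<mu> lam \<mu>c Lc b1 b2 b3 y0 x) (E, K) (H1, H2) (H1, H2)"
      unfolding W_h3_eq D2_shell_energy by simp
    finally show ?thesis .
  qed
  moreover have "a1 > 0" using h d c1_pos v_pos by (simp add: a1_def)
  ultimately show ?thesis by blast
qed

end
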